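(* Let $a,b,c$ be positive numbers with $a<b<c$, $b-a<c_0<a$ (where $c_0=c-\lfloor c/b\rfloor b$), $\lfloor c/b\rfloor\ge2$ and $a/b\notin\mathbb Q$. Assume $\mathcal S_{a,b,c}\ne\emptyset$. Then there is an integer $D$ with $0\le D\le\lfloor a/(b-a)\rfloor-1$ such that (1) $(\tilde R_{a,b,c})^n(c_0+a-b)+a\mathbb Z=(R_{a,b,c})^{D-n}(c-c_0)+a\mathbb Z$ for all $0\le n\le D$; (2) the sets $(R_{a,b,c})^n(c-c_0)+[0,b-a]+a\mathbb Z$, $0\le n\le D$, are pairwise disjoint; (3) $\mathbb R\setminus\mathcal S_{a,b,c}=\bigcup_{n=0}^D\big((R_{a,b,c})^n(c-c_0)+[0,b-a)+a\mathbb Z\big)=\bigcup_{n=0}^D(R_{a,b,c})^n([c-c_0,c-c_0+b-a)+a\mathbb Z)=\bigcup_{n=0}^D(\tilde R_{a,b,c})^n([c_0+a-b,c_0)+a\mathbb Z)=\bigcup_{n=0}^D\big((\tilde R_{a,b,c})^n(c_0+a-b)+[0,b-a)+a\mathbb Z\big)$.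
   Context: For $a,b,c>0$ and $t\in\mathbb R$, $\mathbf M_{a,b,c}(t)=(\chi_{[0,c)}(t-\mu+\lambda))_{\mu\in a\mathbb Z,\lambda\in b\mathbb Z}$ is the infinite matrix with rows indexed by $a\mathbb Z$ and columns by $b\mathbb Z$, acting by $(\mathbf M_{a,b,c}(t)\mathbf x)(\mu)=\sum_{\lambda\in b\mathbb Z}\chi_{[0,c)}(t-\mu+\lambda)\mathbf x(\lambda)$. $\mathcal B_b^0$ is the set of vectors $(\mathbf x(\lambda))_{\lambda\in b\mathbb Z}$ with entries in $\{0,1\}$ and $\mathbf x(0)=1$. $\mathbf 1$ denotes the vector indexed by $a\mathbb Z$ with all entries $1$. $\mathcal S_{a,b,c}=\{t:\mathbf M_{a,b,c}(t)\mathbf x=\mathbf 1\text{ for some }\mathbf x\in\mathcal B_b^0\}$. With $c_0=c-\lfloor c/b\rfloor b$ and $b-a<c_0<a$: $R_{a,b,c}(t)=t+\lfloor c/b\rfloor b+b$ if $t\in[0,c_0+a-b)+a\mathbb Z$, $R_{a,b,c}(t)=t$ if $t\in[c_0+a-b,c_0)+a\mathbb Z$, $R_{a,b,c}(t)=t+\lfloor c/b\rfloor b$ if $t\in[c_0,a)+a\mathbb Z$; $\tilde R_{a,b,c}(t)=t-\lfloor c/b\rfloor b$ if $t\in[c-a,c-c_0)+a\mathbb Z$, $\tilde R_{a,b,c}(t)=t$ if $t\in[c-c_0,c-c_0+b-a)+a\mathbb Z$, $\tilde R_{a,b,c}(t)=t-\lfloor c/b\rfloor b-b$ if $t\in[c-c_0+b-a,c)+a\mathbb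 Z$. $T^n$ is the $n$-fold iterate ($T^0=$ identity), $A+a\mathbb Z=\{x+ak:x\in A,k\in\mathbb Z\}$, and $x+A=\{x+y:y\in A\}$. *)

theory Defs
  imports Complex_Main "HOL-Library.Indicator_Function"
begin

definition shiftset :: "real set \<Rightarrow> real \<Rightarrow> real set" where
  "shiftset A a = {x + a * of_int k | x k. x \<in> A}"

text \<open>The matrix equation M_{a,b,c}(t) x = 1 for x in B_b^0: vectors indexed by bZ are
  represented as functions on int (lambda = b*k); rows mu = a*m.  The row sum
  sum_{lambda} chi_[0,c)(t - mu + lambda) x(lambda) is a finite sum over the k where the
  indicator is nonzero.\<close>
definition Mx_eq_one :: "real \<Rightarrow> real \<Rightarrow> real \<Rightarrow> real \<Rightarrow> (int \<Rightarrow> real) \<Rightarrow> bool" where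
  "Mx_eq_one a b c t x \<longleftrightarrow>
     (\<forall>m::int. (\<Sum>k\<in>{k::int. 0 \<le> t - a * of_int m + b * of_int k \<and> t - a * of_int m + b * of_int k < c}.
                   indicator {0..<c} (t - a * of_int m + b * of_int k) * x k) = 1)"

definition Bb0 :: "(int \<Rightarrow> real) set" where
  "Bb0 = {x. (\<forall>k. x k \<in> {0, 1}) \<and> x 0 = 1}"

definition Sabc :: "real \<Rightarrow> real \<Rightarrow> real \<Rightarrow> real set" where
  "Sabc a b c = {t. \<exists>x\<in>Bb0. Mx_eq_one a b c t x}"

definition c0 :: "real \<Rightarrow> real \<Rightarrow> real" where
  "c0 b c = c - of_int \<lfloor>c / b\<rfloor> * b"

definition Rabc :: "real \<Rightarrow> real \<Rightarrow> real \<Rightarrow> real \<Rightarrow> real" where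
  "Rabc a b c t =
     (if t \<in> shiftset {0..<c0 b c + a - b} a then t + of_int \<lfloor>c / b\<rfloor> * b + b
      else if t \<in> shiftset {c0 b c + a - b..<c0 b c} a then t
      else if t \<in> shiftset {c0 b c..<a} a then t + of_int \<lfloor>c / b\<rfloor> * b
      else undefined)"

definition Rtabc :: "real \<Rightarrow> real \<Rightarrow> real \<Rightarrow> real \<Rightarrow> real" where
  "Rtabc a b c t =
     (if t \<in> shiftset {c - a..<c - c0 b c} a then t - of_int \<lfloor>c / b\<rfloor> * b
      else if t \<in> shiftset {c - c0 b c..<c - c0 b c + b - a} a then t
      else if t \<in> shiftset {c - c0 b c + b - a..<c} a then t - of_int \<lfloor>c / b\<rfloor> * b - b
      else undefined)"

end

theory Submission
  imports Defs
begin

text \<open>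
  A point \<open>t\<close> belongs to \<open>S\<close> iff some subset of \<open>t + b\<int>\<close> containing \<open>t\<close> meets every window
  \<open>[am, am + c)\<close>, \<open>m \<in> \<int>\<close>, exactly once; \<open>R\<close> and \<open>R'\<close> (the paper's \<open>R\<close> with a tilde)
  send a point of such a set to its right and left neighbour.
  Hence \<open>S\<close> consists of the points whose \<open>R\<close>-orbit avoids the hole \<open>H\<close> and whose \<open>R'\<close>-orbit avoids \<open>H'\<close>.

  Modulo \<open>a\<close>, the map \<open>R\<close> closes the hole \<open>H\<close> and opens the hole \<open>H'\<close>, both of length \<open>b - a\<close>,
  at the image of \<open>0\<close>. So \<open>R\<close> preserves the length of the gap of \<open>S\<close> to the left of a point \<open>v\<close> of \<open>S\<close>, except
  that it adds \<open>b - a\<close> if \<open>v\<close> is the first point \<open>v0\<close> of \<open>S\<close> after \<open>0\<close> and subtracts \<open>b - a\<close> if \<open>v\<close> is the first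
  point \<open>vH\<close> of \<open>S\<close> after \<open>H\<close>. As \<open>a / b\<close> is irrational, orbits in \<open>S\<close> are infinite modulo \<open>a\<close>, so no gap length
  \<open>e > 0\<close> can persist along an orbit. Therefore the orbit of \<open>v0\<close> reaches \<open>vH\<close>, the gap left of \<open>v0\<close> is trivial,
  the one left of \<open>vH\<close> is exactly \<open>H\<close>, and there are no gaps besides those between \<open>v0\<close> and \<open>vH\<close>.
\<close>

section \<open>Periodic sets, cells of length \<open>a\<close>, and piecewise translations\<close>

lemma mem_shiftset_iff: "t \<in> shiftset A a \<longleftrightarrow> (\<exists>k::int. t - a * of_int k \<in> A)"
proof -
  have "t = x + y \<longleftrightarrow> t - y = x" for x y :: real by auto
  then show ?thesis
    unfolding shiftset_def by auto
qed

lemma mem_shiftset_atLeastLessThan: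
  "t \<in> shiftset {l..<u} a \<longleftrightarrow> (\<exists>k::int. l + a * of_int k \<le> t \<and> t < u + a * of_int k)"
  unfolding mem_shiftset_iff by (auto simp: algebra_simps)

lemma floor_cell_unique:
  fixes a t :: real and k m :: int
  assumes "0 < a" "a * of_int k \<le> t" "t < a * of_int k + a" "a * of_int m \<le> t" "t < a * of_int m + a"
  shows "k = m"
proof -
  have "a * of_int k < a * of_int (m + 1)" "a * of_int m < a * of_int (k + 1)"
    using assms by (auto simp: algebra_simps)
  then have "k < m + 1" "m < k + 1"
    using \<open>0 < a\<close> by (simp_all only: mult_less_cancel_left_pos of_int_less_iff)
  then show ?thesis by simp
qed

lemma obtain_floor_cell:
  fixes a t :: real
  assumes "0 < a"
  obtains k :: int where "a * of_int k \<le> t" "t < a * of_int k + a"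
proof
  show "a * of_int \<lfloor>t / a\<rfloor> \<le> t"
    using floor_divide_lower[OF assms, of t] by (simp add: mult.commute)
  show "t < a * of_int \<lfloor>t / a\<rfloor> + a"
    using floor_divide_upper[OF assms, of t] by (simp add: algebra_simps)
qed

text \<open>A map that is a rigid translation just to the right of every point carries a short right
  neighbourhood onto a right neighbourhood of the image, so the property passes to
  compositions.\<close>

lemma funpow_right_continuous:
  fixes f :: "real \<Rightarrow> real"
  assumes "\<And>t. \<exists>e>0. \<forall>y. 0 \<le> y \<and> y < e \<longrightarrow> f (t + y) = f t + y"
  shows "\<exists>e>0. \<forall>y. 0 \<le> y \<and> y < e \<longrightarrow> (f ^^ n) (t + y) = (f ^^ n) t + y"
proof (induction n)
  case 0
  show ?case by (intro exI[of _ 1]) simp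
next
  case (Suc n)
  then obtain e where e: "e > 0" "\<forall>y. 0 \<le> y \<and> y < e \<longrightarrow> (f ^^ n) (t + y) = (f ^^ n) t + y"
    by blast
  obtain e' where e': "e' > 0" "\<forall>y. 0 \<le> y \<and> y < e' \<longrightarrow> f ((f ^^ n) t + y) = f ((f ^^ n) t) + y"
    using assms by blast
  show ?case
    using e e' by (intro exI[of _ "min e e'"]) simp
qed

lemma shiftset_right_open:
  assumes "t \<in> shiftset {l..<u} a"
  shows "\<exists>e>0. \<forall>y. 0 \<le> y \<and> y < e \<longrightarrow> t + y \<in> shiftset {l..<u} a"
proof -
  obtain k :: int where k: "l + a * of_int k \<le> t" "t < u + a * of_int k"
    using assms unfolding mem_shiftset_atLeastLessThan by blast
  have "t + y \<in> shiftset {l..<u} a" if "0 \<le> y \<and> y < u + a * of_int k - t" for y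
    unfolding mem_shiftset_atLeastLessThan using that k by (intro exI[of _ k]) auto
  then show ?thesis
    using k by (intro exI[of _ "u + a * of_int k - t"]) auto
qed

lemma mem_shiftset_translate:
  "p \<in> shiftset ((\<lambda>y. x + y) ` A) a \<longleftrightarrow> (\<exists>y\<in>A. \<exists>k::int. p = x + y + a * of_int k)"
  unfolding shiftset_def by blast

text \<open>Reduces the image of a periodic family of arcs to a pointwise check that
  \<open>f\<close> moves each arc rigidly and commutes with the period.\<close>

lemma image_shiftset_translate:
  assumes "\<And>y (k::int). y \<in> A \<Longrightarrow> f (x + y + a * of_int k) = x' + y + a * of_int k"
  shows "f ` shiftset ((\<lambda>y. x + y) ` A) a = shiftset ((\<lambda>y. x' + y) ` A) a"
proof (intro set_eqI iffI)
  fix p assume "p \<in> f ` shiftset ((\<lambda>y. x + y) ` A) a"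
  then obtain y and k :: int where "y \<in> A" "p = f (x + y + a * of_int k)"
    unfolding image_iff Bex_def mem_shiftset_translate by blast
  then show "p \<in> shiftset ((\<lambda>y. x' + y) ` A) a"
    using assms unfolding mem_shiftset_translate by blast
next
  fix p assume "p \<in> shiftset ((\<lambda>y. x' + y) ` A) a"
  then obtain y and k :: int where "y \<in> A" "p = x' + y + a * of_int k"
    unfolding mem_shiftset_translate by blast
  then have "p = f (x + y + a * of_int k)" "x + y + a * of_int k \<in> shiftset ((\<lambda>y. x + y) ` A) a"
    using assms unfolding mem_shiftset_translate by auto
  then show "p \<in> f ` shiftset ((\<lambda>y. x + y) ` A) a" by blast
qed

section \<open>The pieces of the maps \<open>R\<close> and \<open>R'\<close>\<close>

locale abc_params =
  fixes a b c :: real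
  assumes a_pos: "0 < a" and a_less_b: "a < b" and b_less_c: "b < c"
    and c0_lower: "b - a < c0 b c" and c0_upper: "c0 b c < a"
    and floor_ge_2: "\<lfloor>c / b\<rfloor> \<ge> 2"
    and irrational: "a / b \<notin> \<rat>"
begin

text \<open>In the paper's notation \<open>z\<close> is \<open>c\<^sub>0\<close> and \<open>Q\<close> is \<open>c - c\<^sub>0\<close>.\<close>

definition Q :: real where "Q = of_int \<lfloor>c / b\<rfloor> * b"

abbreviation z :: real where "z \<equiv> c0 b c"

abbreviation R :: "real \<Rightarrow> real" where "R \<equiv> Rabc a b c"

abbreviation R' :: "real \<Rightarrow> real" where "R' \<equiv> Rtabc a b c"

abbreviation S :: "real set" where "S \<equiv> Sabc a b c"

text \<open>The arcs fixed pointwise by \<open>R\<close>; \<open>H'\<close> plays the same part for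
  \<open>R'\<close>. By \<open>succ_R\<close> and \<open>succD\<close> below, they are exactly the
  points without a right, respectively left, neighbour in the sense of \<open>succ\<close>.\<close>

definition H :: "real set" where "H = shiftset {z + a - b..<z} a"

definition H' :: "real set" where "H' = shiftset {Q..<Q + b - a} a"

lemma c_eq: "c = Q + z"
  by (simp add: Q_def c0_def)

lemma Q_ge: "2 * b \<le> Q"
proof -
  have "2 * b \<le> of_int \<lfloor>c / b\<rfloor> * b"
    using floor_ge_2 a_pos a_less_b by (intro mult_right_mono) auto
  then show ?thesis by (simp add: Q_def)
qed

lemmas params = a_pos a_less_b c0_lower c0_upper Q_ge

lemma mem_H_iff:
  assumes "a * of_int k \<le> t" "t < a * of_int k + a"
  shows "t \<in> H \<longleftrightarrow> a * of_int k + z + a - b \<le> t \<and> t < a * of_int k + z"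
proof
  assume "t \<in> H"
  then obtain m :: int where m: "z + a - b + a * of_int m \<le> t" "t < z + a * of_int m"
    unfolding H_def mem_shiftset_atLeastLessThan by blast
  have "k = m"
    using floor_cell_unique[OF a_pos assms, of m] m params by simp
  then show "a * of_int k + z + a - b \<le> t \<and> t < a * of_int k + z"
    using m by simp
next
  assume "a * of_int k + z + a - b \<le> t \<and> t < a * of_int k + z"
  then show "t \<in> H"
    unfolding H_def mem_shiftset_atLeastLessThan by (intro exI[of _ k]) simp
qed

lemma R_alt:
  "R t = (if t \<in> shiftset {0..<z + a - b} a then t + Q + b
          else if t \<in> H then t
          else if t \<in> shiftset {z..<a} a then t + Q
          else undefined)"
  by (simp add: Rabc_def Q_def H_def)

lemma R'_alt:
  "R' t = (if t \<in> shiftset {Q + z - a..<Q} a then t - Q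
          else if t \<in> H' then t
          else if t \<in> shiftset {Q + b - a..<Q + z} a then t - Q - b
          else undefined)"
proof -
  have *: "{c - a..<c - z} = {Q + z - a..<Q}" "{c - z..<c - z + b - a} = {Q..<Q + b - a}"
      "{c - z + b - a..<c} = {Q + b - a..<Q + z}"
    using c_eq by auto
  show ?thesis
    unfolding Rtabc_def H'_def * Q_def[symmetric] ..
qed

lemma R_left:
  assumes "a * of_int k \<le> t" "t < a * of_int k + z + a - b"
  shows "t \<notin> H" "R t = t + Q + b"
proof -
  show "t \<notin> H"
    using mem_H_iff[of k t] assms params by auto
  have "t \<in> shiftset {0..<z + a - b} a"
    unfolding mem_shiftset_atLeastLessThan using assms by (intro exI[of _ k]) simp
  then show "R t = t + Q + b"
    by (simp add: R_alt)
qed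

lemma R_right:
  assumes "a * of_int k + z \<le> t" "t < a * of_int k + a"
  shows "t \<notin> H" "R t = t + Q"
proof -
  have k: "a * of_int k \<le> t"
    using assms params by simp
  show "t \<notin> H"
    using mem_H_iff[of k t] k assms params by auto
  moreover have "t \<notin> shiftset {0..<z + a - b} a"
  proof
    assume "t \<in> shiftset {0..<z + a - b} a"
    then obtain m :: int where m: "a * of_int m \<le> t" "t < z + a - b + a * of_int m"
      unfolding mem_shiftset_atLeastLessThan by auto
    have "k = m"
      using floor_cell_unique[OF a_pos k assms(2), of m] m params by simp
    then show False
      using m assms params by simp
  qed
  moreover have "t \<in> shiftset {z..<a} a"
    unfolding mem_shiftset_atLeastLessThan using assms by (intro exI[of _ k]) simp
  ultimately show "R t = t + Q"
    by (simp add: R_alt)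
qed

lemma R_hole: "t \<in> H \<Longrightarrow> R t = t"
proof -
  assume "t \<in> H"
  then have "t \<notin> shiftset {0..<z + a - b} a"
    using R_left(1) by (auto simp: mem_shiftset_atLeastLessThan algebra_simps)
  with \<open>t \<in> H\<close> show ?thesis
    by (simp add: R_alt)
qed

text \<open>The cell \<open>[Q + z - a, Q + z)\<close>, which is \<open>[c - a, c)\<close>, is the
  fundamental domain in which the three pieces of \<open>R'\<close> appear in order.\<close>

lemma mem_H'_iff:
  assumes "Q + z - a + a * of_int k \<le> p" "p < Q + z + a * of_int k"
  shows "p \<in> H' \<longleftrightarrow> Q + a * of_int k \<le> p \<and> p < Q + b - a + a * of_int k"
proof
  assume "p \<in> H'"
  then obtain m :: int where m: "Q + a * of_int m \<le> p" "p < Q + b - a + a * of_int m"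
    unfolding H'_def mem_shiftset_atLeastLessThan by blast
  have "k = m"
    using floor_cell_unique[OF a_pos, of k "p - Q - z + a" m] m assms params by simp
  then show "Q + a * of_int k \<le> p \<and> p < Q + b - a + a * of_int k"
    using m by simp
next
  assume "Q + a * of_int k \<le> p \<and> p < Q + b - a + a * of_int k"
  then show "p \<in> H'"
    unfolding H'_def mem_shiftset_atLeastLessThan by (intro exI[of _ k]) simp
qed

lemma R'_right:
  assumes "Q + z - a + a * of_int k \<le> p" "p < Q + a * of_int k"
  shows "p \<notin> H'" "R' p = p - Q"
proof -
  show "p \<notin> H'"
    using mem_H'_iff[of k p] assms params by auto
  have "p \<in> shiftset {Q + z - a..<Q} a"
    unfolding mem_shiftset_atLeastLessThan using assms by (intro exI[of _ k]) simp
  then show "R' p = p - Q"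
    by (simp add: R'_alt)
qed

lemma R'_left:
  assumes "Q + b - a + a * of_int k \<le> p" "p < Q + z + a * of_int k"
  shows "p \<notin> H'" "R' p = p - Q - b"
proof -
  have k: "Q + z - a + a * of_int k \<le> p"
    using assms params by simp
  show "p \<notin> H'"
    using mem_H'_iff[of k p] k assms params by auto
  moreover have "p \<notin> shiftset {Q + z - a..<Q} a"
  proof
    assume "p \<in> shiftset {Q + z - a..<Q} a"
    then obtain m :: int where m: "Q + z - a + a * of_int m \<le> p" "p < Q + a * of_int m"
      unfolding mem_shiftset_atLeastLessThan by auto
    have "k = m"
      using floor_cell_unique[OF a_pos, of k "p - Q - z + a" m] m k assms params by simp
    then show False
      using m assms params by simp
  qed
  moreover have "p \<in> shiftset {Q + b - a..<Q + z} a"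
    unfolding mem_shiftset_atLeastLessThan using assms by (intro exI[of _ k]) simp
  ultimately show "R' p = p - Q - b"
    by (simp add: R'_alt)
qed

section \<open>The neighbour relation behind \<open>R\<close> and \<open>R'\<close>\<close>

text \<open>When the window \<open>[am, am + c)\<close> slides to
  \<open>[a(m + 1), a(m + 1) + c)\<close>, it loses the first \<open>a\<close> units and gains
  \<open>a\<close> units at the end. The relation says that \<open>t\<close> is lost and
  \<open>p\<close> is gained in the same slide, both on one coset of \<open>b\<close> times the
  integers.\<close>

definition succ :: "real \<Rightarrow> real \<Rightarrow> bool" where
  "succ t p \<longleftrightarrow> (\<exists>m j :: int. a * of_int m \<le> t \<and> t < a * of_int m + a \<and>
     a * of_int m + c \<le> p \<and> p < a * of_int m + a + c \<and> p = t + b * of_int j)"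

lemma succ_left:
  assumes "a * of_int k \<le> t" "t < a * of_int k + z + a - b"
  shows "succ t (t + Q + b)"
  unfolding succ_def using assms params c_eq
  by (intro exI[of _ k] exI[of _ "\<lfloor>c / b\<rfloor> + 1"]) (auto simp: Q_def algebra_simps)

lemma succ_right:
  assumes "a * of_int k + z \<le> t" "t < a * of_int k + a"
  shows "succ t (t + Q)"
  unfolding succ_def using assms params c_eq
  by (intro exI[of _ k] exI[of _ "\<lfloor>c / b\<rfloor>"]) (auto simp: Q_def algebra_simps)

lemma not_hole_cases:
  assumes "t \<notin> H"
  obtains (left) k :: int where "a * of_int k \<le> t" "t < a * of_int k + z + a - b"
    | (right) k :: int where "a * of_int k + z \<le> t" "t < a * of_int k + a"
proof -
  obtain k :: int where "a * of_int k \<le> t" "t < a * of_int k + a"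
    using obtain_floor_cell[OF a_pos] .
  then show ?thesis
    using mem_H_iff[of k t] assms left right by force
qed

lemma not_cohole_cases:
  assumes "p \<notin> H'"
  obtains (left) k :: int where "Q + b - a + a * of_int k \<le> p" "p < Q + z + a * of_int k"
    | (right) k :: int where "Q + z - a + a * of_int k \<le> p" "p < Q + a * of_int k"
proof -
  obtain k :: int where "a * of_int k \<le> p - Q - z + a" "p - Q - z + a < a * of_int k + a"
    using obtain_floor_cell[OF a_pos] .
  then have k: "Q + z - a + a * of_int k \<le> p" "p < Q + z + a * of_int k"
    by simp_all
  then have "p < Q + a * of_int k \<or> Q + b - a + a * of_int k \<le> p"
    using mem_H'_iff[of k p] assms by auto
  then show ?thesis
    using k left[of k] right[of k] by blast
qed

lemma succ_R: "t \<notin> H \<Longrightarrow> succ t (R t)"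
  by (erule not_hole_cases) (simp_all add: R_left R_right succ_left succ_right)

lemma succ_R': "p \<notin> H' \<Longrightarrow> succ (R' p) p"
proof (erule not_cohole_cases)
  fix k :: int
  assume k: "Q + b - a + a * of_int k \<le> p" "p < Q + z + a * of_int k"
  have "succ (p - Q - b) ((p - Q - b) + Q + b)"
    using k by (intro succ_left[of "k - 1"]) (simp_all add: algebra_simps)
  then show ?thesis
    using R'_left[OF k] by simp
next
  fix k :: int
  assume k: "Q + z - a + a * of_int k \<le> p" "p < Q + a * of_int k"
  have "succ (p - Q) ((p - Q) + Q)"
    using k by (intro succ_right[of "k - 1"]) (simp_all add: algebra_simps)
  then show ?thesis
    using R'_right[OF k] by simp
qed

text \<open>Together with \<open>succ_R\<close> and \<open>succ_R'\<close> this identifies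
  \<open>succ\<close> with the graph of \<open>R\<close> off \<open>H\<close> and with the reversed
  graph of \<open>R'\<close> off \<open>H'\<close>. Hence \<open>R\<close> and \<open>R'\<close> are
  mutually inverse bijections between the complements of the two holes.\<close>

lemma succD:
  assumes "succ t p"
  shows "t \<notin> H" "R t = p" "p \<notin> H'" "R' p = t"
proof -
  obtain m j :: int where m: "a * of_int m \<le> t" "t < a * of_int m + a"
      "a * of_int m + c \<le> p" "p < a * of_int m + a + c" and j: "p = t + b * of_int j"
    using assms unfolding succ_def by blast
  \<comment> \<open>\<open>i\<close> counts lattice steps beyond the shorter jump \<open>Q\<close>.
    The cells of \<open>t\<close> and \<open>p\<close> confine \<open>p - t - Q\<close> strictly
    between \<open>- b\<close> and \<open>2 * b\<close>, which leaves only \<open>0\<close> and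
    \<open>1\<close>.\<close>
  define i where "i = j - \<lfloor>c / b\<rfloor>"
  have p: "p = t + Q + b * of_int i"
    by (simp add: j i_def Q_def algebra_simps)
  have "- b < b * of_int i" "b * of_int i < 2 * b"
    using m p c_eq params by linarith+
  then have "- 1 < i" "i < 2"
    using a_pos a_less_b mult_less_cancel_left_pos[of b "- 1" "of_int i"]
      mult_less_cancel_left_pos[of b "of_int i" 2] by auto
  then consider "i = 0" | "i = 1" by linarith
  then have "t \<notin> H \<and> R t = p \<and> p \<notin> H' \<and> R' p = t"
  proof cases
    case 1
    then have "a * of_int m + z \<le> t" "Q + z - a + a * of_int (m + 1) \<le> p" "p < Q + a * of_int (m + 1)"
      using m p c_eq by (auto simp: algebra_simps)
    then show ?thesis
      using R_right[of m t] R'_right[of "m + 1" p] m 1 p by simp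
  next
    case 2
    then have "t < a * of_int m + z + a - b"
        "Q + b - a + a * of_int (m + 1) \<le> p" "p < Q + z + a * of_int (m + 1)"
      using m p c_eq by (auto simp: algebra_simps)
    then show ?thesis
      using R_left[of m t] R'_left[of "m + 1" p] m 2 p by simp
  qed
  then show "t \<notin> H" "R t = p" "p \<notin> H'" "R' p = t" by auto
qed

lemma R'_R: "t \<notin> H \<Longrightarrow> R' (R t) = t"
  using succ_R succD by blast

lemma R_R': "p \<notin> H' \<Longrightarrow> R (R' p) = p" and R'_notin_hole: "p \<notin> H' \<Longrightarrow> R' p \<notin> H"
  using succ_R' succD by blast+

text \<open>The positivity of \<open>j\<close> later prevents orbits from closing up modulo
  \<open>a\<close>.\<close>

lemma R_step:
  assumes "t \<notin> H"
  obtains j :: int where "0 < j" "R t = t + b * of_int j"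
proof -
  from succ_R[OF assms] obtain j :: int where j: "R t = t + b * of_int j"
    unfolding succ_def by blast
  have "R t \<ge> t + Q"
    using assms a_pos a_less_b by (cases rule: not_hole_cases) (simp_all add: R_left R_right)
  then have "0 < b * of_int j"
    using j params by linarith
  then have "0 < j"
    using a_pos a_less_b by (simp add: zero_less_mult_iff)
  then show ?thesis
    using that j by blast
qed

lemma H_shift: "t + a * of_int k \<in> H \<longleftrightarrow> t \<in> H"
proof -
  have "t + a * of_int k \<in> H" if "t \<in> H" for t and k :: int
    using that unfolding H_def mem_shiftset_iff
    by (auto simp: algebra_simps intro: exI[of _ "_ + k"])
  from this[of t k] this[of "t + a * of_int k" "- k"] show ?thesis by auto
qed

lemma R_shift: "R (t + a * of_int k) = R t + a * of_int k"
proof (cases "t \<in> H")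
  case True
  then show ?thesis by (simp add: R_hole H_shift)
next
  case False
  then show ?thesis
  proof (cases rule: not_hole_cases)
    case (left m)
    then show ?thesis
      using R_left[of m t] R_left[of "m + k" "t + a * of_int k"] by (simp add: algebra_simps)
  next
    case (right m)
    then show ?thesis
      using R_right[of m t] R_right[of "m + k" "t + a * of_int k"] by (simp add: algebra_simps)
  qed
qed

lemma R_funpow_shift: "(R ^^ n) (t + a * of_int k) = (R ^^ n) t + a * of_int k"
  by (induction n) (simp_all add: R_shift)

lemma b_pos: "0 < b"
  using a_pos a_less_b by simp

subsection \<open>Window sets and orbits\<close>

text \<open>For a 0/1 vector the row sum counts the selected lattice points in the window
  \<open>[am, am + c)\<close>.\<close>

lemma row_sum_eq_1_iff:
  fixes x :: "int \<Rightarrow> real" and m :: int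
  assumes x: "\<And>k. x k \<in> {0, 1}"
  shows "(\<Sum>k\<in>{k::int. 0 \<le> t - a * of_int m + b * of_int k \<and> t - a * of_int m + b * of_int k < c}.
            indicator {0..<c} (t - a * of_int m + b * of_int k) * x k) = 1 \<longleftrightarrow>
         (\<exists>!k. x k = 1 \<and> a * of_int m \<le> t + b * of_int k \<and> t + b * of_int k < a * of_int m + c)"
    (is "(\<Sum>k\<in>?W. _) = 1 \<longleftrightarrow> _")
proof -
  \<comment> \<open>Finiteness matters, because a sum over an infinite index set is 0 by
    convention.\<close>
  have "?W \<subseteq> {\<lceil>(a * of_int m - t) / b\<rceil>..\<lfloor>(a * of_int m - t + c) / b\<rfloor>}"
  proof
    fix k assume "k \<in> ?W"
    then show "k \<in> {\<lceil>(a * of_int m - t) / b\<rceil>..\<lfloor>(a * of_int m - t + c) / b\<rfloor>}"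
      using b_pos by (auto simp: ceiling_le_iff le_floor_iff field_simps)
  qed
  then have fin: "finite ?W"
    using finite_subset by blast
  have "(\<Sum>k\<in>?W. indicator {0..<c} (t - a * of_int m + b * of_int k) * x k)
      = (\<Sum>k\<in>?W. if x k = 1 then 1 else 0)"
    by (intro sum.cong refl) (use x in \<open>auto simp: indicator_def\<close>)
  also have "\<dots> = real (card {k \<in> ?W. x k = 1})"
    using fin by (simp add: sum.If_cases Int_def)
  finally have "(\<Sum>k\<in>?W. indicator {0..<c} (t - a * of_int m + b * of_int k) * x k) = 1 \<longleftrightarrow>
      card {k \<in> ?W. x k = 1} = 1"
    by simp
  also have "\<dots> \<longleftrightarrow> (\<exists>!k. k \<in> {k \<in> ?W. x k = 1})"
  proof -
    have "(\<exists>k. A = {k}) \<longleftrightarrow> (\<exists>!k. k \<in> A)" for A :: "int set" by blast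
    then show ?thesis
      unfolding One_nat_def card_1_singleton_iff by blast
  qed
  also have "\<dots> \<longleftrightarrow> (\<exists>!k. x k = 1 \<and> a * of_int m \<le> t + b * of_int k \<and> t + b * of_int k < a * of_int m + c)"
    by (intro arg_cong[of _ _ Ex1] ext) auto
  finally show ?thesis .
qed

text \<open>\<open>K\<close> is the support of the solution vector, so \<open>0 \<in> K\<close>
  encodes the normalisation in \<open>Bb0\<close>.\<close>

definition tiling :: "real \<Rightarrow> int set \<Rightarrow> bool" where
  "tiling t K \<longleftrightarrow>
     (\<forall>m::int. \<exists>!k. k \<in> K \<and> a * of_int m \<le> t + b * of_int k \<and> t + b * of_int k < a * of_int m + c)"

lemma mem_S_iff: "t \<in> S \<longleftrightarrow> (\<exists>K. 0 \<in> K \<and> tiling t K)"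
proof
  assume "t \<in> S"
  then obtain x where x: "\<And>k. x k \<in> {0, 1}" "x 0 = 1" "Mx_eq_one a b c t x"
    unfolding Sabc_def Bb0_def by auto
  have "tiling t {k. x k = 1}"
    using x(3) unfolding tiling_def Mx_eq_one_def row_sum_eq_1_iff[OF x(1)] mem_Collect_eq .
  with x(2) show "\<exists>K. 0 \<in> K \<and> tiling t K"
    by (intro exI[of _ "{k. x k = 1}"]) simp
next
  assume "\<exists>K. 0 \<in> K \<and> tiling t K"
  then obtain K where K: "0 \<in> K" "tiling t K" by blast
  have x: "(indicator K k :: real) \<in> {0, 1}" "(indicator K k :: real) = 1 \<longleftrightarrow> k \<in> K" for k
    by (auto simp: indicator_def)
  have "Mx_eq_one a b c t (indicator K)"
    using K(2) unfolding Mx_eq_one_def tiling_def row_sum_eq_1_iff[OF x(1)] x(2) .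
  moreover have "indicator K \<in> Bb0"
    using K(1) x by (auto simp: Bb0_def)
  ultimately show "t \<in> S"
    unfolding Sabc_def by blast
qed

lemma tiling_member_mem_S:
  assumes K: "tiling t K" and "k \<in> K"
  shows "t + b * of_int k \<in> S"
proof -
  have "tiling (t + b * of_int k) {j. j + k \<in> K}"
    unfolding tiling_def
  proof
    fix m :: int
    obtain i where i: "i \<in> K \<and> a * of_int m \<le> t + b * of_int i \<and> t + b * of_int i < a * of_int m + c"
      and uniq: "\<And>j. j \<in> K \<and> a * of_int m \<le> t + b * of_int j \<and> t + b * of_int j < a * of_int m + c \<Longrightarrow> j = i"
      using K unfolding tiling_def by metis
    show "\<exists>!j. j \<in> {j. j + k \<in> K} \<and> a * of_int m \<le> t + b * of_int k + b * of_int j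
            \<and> t + b * of_int k + b * of_int j < a * of_int m + c"
    proof (rule ex1I[of _ "i - k"])
      show "i - k \<in> {j. j + k \<in> K} \<and> a * of_int m \<le> t + b * of_int k + b * of_int (i - k)
            \<and> t + b * of_int k + b * of_int (i - k) < a * of_int m + c"
        using i by (simp add: algebra_simps)
    next
      fix j
      assume "j \<in> {j. j + k \<in> K} \<and> a * of_int m \<le> t + b * of_int k + b * of_int j
            \<and> t + b * of_int k + b * of_int j < a * of_int m + c"
      then have "j + k = i"
        by (intro uniq) (simp add: algebra_simps)
      then show "j = i - k" by simp
    qed
  qed
  then show ?thesis
    using \<open>k \<in> K\<close> unfolding mem_S_iff by (intro exI[of _ "{j. j + k \<in> K}"]) simp
qed

lemma S_shift_imp: "t \<in> S \<Longrightarrow> t + a * of_int k \<in> S"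
proof -
  assume "t \<in> S"
  then obtain K where K: "0 \<in> K" "tiling t K"
    unfolding mem_S_iff by blast
  have "tiling (t + a * of_int k) K"
    unfolding tiling_def
  proof
    fix m :: int
    have "\<exists>!j. j \<in> K \<and> a * of_int (m - k) \<le> t + b * of_int j \<and> t + b * of_int j < a * of_int (m - k) + c"
      using K(2) unfolding tiling_def by blast
    moreover have "a * of_int (m - k) \<le> t + b * of_int j \<and> t + b * of_int j < a * of_int (m - k) + c \<longleftrightarrow>
        a * of_int m \<le> t + a * of_int k + b * of_int j \<and> t + a * of_int k + b * of_int j < a * of_int m + c"
      for j :: int
      by (auto simp: algebra_simps)
    ultimately show "\<exists>!j. j \<in> K \<and> a * of_int m \<le> t + a * of_int k + b * of_int j
        \<and> t + a * of_int k + b * of_int j < a * of_int m + c"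
      by simp
  qed
  with K(1) show ?thesis
    unfolding mem_S_iff by blast
qed

lemma S_shift: "t + a * of_int k \<in> S \<longleftrightarrow> t \<in> S"
  using S_shift_imp[of t k] S_shift_imp[of "t + a * of_int k" "- k"] by auto

text \<open>The slide from window \<open>m\<close> to window \<open>m + 1\<close> loses
  \<open>t\<close>. The unique selected point of the new window cannot lie in the old one, where
  \<open>t\<close> is already the unique selected point, so it was just gained.\<close>

lemma S_succ:
  assumes "t \<in> S"
  obtains p where "p \<in> S" "succ t p"
proof -
  obtain K where K: "0 \<in> K" "tiling t K"
    using assms unfolding mem_S_iff by blast
  obtain m :: int where m: "a * of_int m \<le> t" "t < a * of_int m + a"
    using obtain_floor_cell[OF a_pos] .
  obtain k where k: "k \<in> K" "a * of_int (m + 1) \<le> t + b * of_int k" "t + b * of_int k < a * of_int (m + 1) + c"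
    using K(2) unfolding tiling_def by metis
  have "k \<noteq> 0"
    using k m by (auto simp: algebra_simps)
  moreover have "k = 0" if "t + b * of_int k < a * of_int m + c"
  proof -
    have "a * of_int m \<le> t + b * of_int k" "t + b * of_int k < a * of_int m + c"
        "a * of_int m \<le> t + b * of_int 0" "t + b * of_int 0 < a * of_int m + c"
      using k(2) that m a_pos b_less_c a_less_b by (auto simp: algebra_simps)
    then show ?thesis
      using K k(1) unfolding tiling_def by blast
  qed
  ultimately have "a * of_int m + c \<le> t + b * of_int k"
    by force
  moreover have "t + b * of_int k < a * of_int m + a + c"
    using k by (simp add: algebra_simps)
  ultimately have "succ t (t + b * of_int k)"
    unfolding succ_def using m by blast
  with tiling_member_mem_S[OF K(2) k(1)] show ?thesis
    by (rule that)
qed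

text \<open>Mirror image of \<open>S_succ\<close>: \<open>p\<close> is gained by window
  \<open>m + 1\<close>, so the selected point of window \<open>m\<close> must be the one that is
  lost.\<close>

lemma S_pred:
  assumes "p \<in> S"
  obtains t where "t \<in> S" "succ t p"
proof -
  obtain K where K: "0 \<in> K" "tiling p K"
    using assms unfolding mem_S_iff by blast
  obtain m :: int where m: "a * of_int m \<le> p - c" "p - c < a * of_int m + a"
    using obtain_floor_cell[OF a_pos] .
  obtain k where k: "k \<in> K" "a * of_int m \<le> p + b * of_int k" "p + b * of_int k < a * of_int m + c"
    using K(2) unfolding tiling_def by metis
  have "k \<noteq> 0"
    using k m by auto
  moreover have "k = 0" if "a * of_int m + a \<le> p + b * of_int k"
  proof -
    have "a * of_int (m + 1) \<le> p + b * of_int k" "p + b * of_int k < a * of_int (m + 1) + c"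
        "a * of_int (m + 1) \<le> p + b * of_int 0" "p + b * of_int 0 < a * of_int (m + 1) + c"
      using k that m a_pos b_less_c a_less_b by (auto simp: algebra_simps)
    then show ?thesis
      using K k(1) unfolding tiling_def by blast
  qed
  ultimately have "p + b * of_int k < a * of_int m + a"
    by force
  moreover have "a * of_int m + c \<le> p" "p < a * of_int m + a + c"
    "p = p + b * of_int k + b * of_int (- k)"
    using m by simp_all
  ultimately have "succ (p + b * of_int k) p"
    unfolding succ_def using k by blast
  with tiling_member_mem_S[OF K(2) k(1)] show ?thesis
    by (rule that)
qed

lemma S_notin_hole: "t \<in> S \<Longrightarrow> t \<notin> H" and S_R: "t \<in> S \<Longrightarrow> R t \<in> S"
  using S_succ succD by metis+

lemma S_notin_cohole: "t \<in> S \<Longrightarrow> t \<notin> H'" and S_R': "t \<in> S \<Longrightarrow> R' t \<in> S"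
  using S_pred succD by metis+

lemma S_R_funpow: "t \<in> S \<Longrightarrow> (R ^^ n) t \<in> S"
  by (induction n) (simp_all add: S_R)

lemma S_R'_funpow: "t \<in> S \<Longrightarrow> (R' ^^ n) t \<in> S"
  by (induction n) (simp_all add: S_R')

lemma succ_ge:
  assumes "succ t p"
  shows "t + b \<le> p"
proof -
  obtain j :: int where j: "0 < j" "p = t + b * of_int j"
    using R_step[OF succD(1)[OF assms]] succD(2)[OF assms] by metis
  then have "b * 1 \<le> b * of_int j"
    using b_pos by (intro mult_left_mono) auto
  then show ?thesis
    using j by simp
qed

text \<open>The converse of \<open>S_succ\<close> and \<open>S_pred\<close>: the points of a
  two-sided chain form a tiling, because every window contains the first chain point at or after its
  left end and no other.\<close>

lemma bi_orbit_mem_S: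
  fixes p :: "int \<Rightarrow> real"
  assumes p: "\<And>n. succ (p n) (p (n + 1))"
  shows "p 0 \<in> S"
proof -
  have growth: "p n + b * of_nat k \<le> p (n + int k)" for n k
  proof (induction k)
    case (Suc k)
    then show ?case
      using succ_ge[OF p[of "n + int k"]] by (simp add: algebra_simps)
  qed simp
  have mono: "p n \<le> p m" if "n \<le> m" for n m
  proof -
    have "p n \<le> p n + b * of_nat (nat (m - n))"
      using b_pos by simp
    then show ?thesis
      using growth[of n "nat (m - n)"] that by simp
  qed
  have step: "\<exists>j::int. p (n + 1) = p n + b * of_int j" for n
    using p[of n] unfolding succ_def by blast
  have lattice: "\<exists>j::int. p n = p 0 + b * of_int j" for n
  proof (induction n rule: int_induct[where k = 0])
    case base
    show ?case by (rule exI[of _ 0]) simp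
  next
    case (step1 i)
    then obtain j j' :: int where "p i = p 0 + b * of_int j" "p (i + 1) = p i + b * of_int j'"
      using step by blast
    then show ?case
      by (intro exI[of _ "j + j'"]) (simp add: algebra_simps)
  next
    case (step2 i)
    then obtain j j' :: int where "p i = p 0 + b * of_int j" "p (i - 1 + 1) = p (i - 1) + b * of_int j'"
      using step by blast
    then show ?case
      by (intro exI[of _ "j - j'"]) (simp add: algebra_simps)
  qed
  define K where "K = {k::int. \<exists>n. p n = p 0 + b * of_int k}"
  have "tiling (p 0) K"
    unfolding tiling_def
  proof
    fix m :: int
    obtain N :: nat where N: "p 0 - a * of_int m < b * of_nat N" "a * of_int m - p 0 < b * of_nat N"
    proof -
      obtain N :: nat where "\<bar>p 0 - a * of_int m\<bar> / b < of_nat N"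
        using reals_Archimedean2 by blast
      then show ?thesis
        using that[of N] b_pos by (simp add: field_simps abs_less_iff)
    qed
    have low: "p (- int N) < a * of_int m"
      using growth[of "- int N" N] N by simp
    have "a * of_int m \<le> p (- int N + int (N + N))"
      using growth[of 0 N] N by simp
    then have ex: "\<exists>k. a * of_int m \<le> p (- int N + int k)" by blast
    \<comment> \<open>The search starts at index \<open>- int N\<close>, where the chain is still to
      the left of the window; hence the least index is not \<open>0\<close> and the point before it
      lies below the window.\<close>
    define k0 where "k0 = (LEAST k. a * of_int m \<le> p (- int N + int k))"
    define n where "n = - int N + int k0"
    have n1: "a * of_int m \<le> p n"
      unfolding n_def k0_def using ex by (rule LeastI_ex)
    have "k0 \<noteq> 0"
    proof
      assume "k0 = 0"
      then show False
        using n1 low by (simp add: n_def)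
    qed
    then have "\<not> a * of_int m \<le> p (- int N + int (k0 - 1))"
      using not_less_Least[of "k0 - 1" "\<lambda>k. a * of_int m \<le> p (- int N + int k)"]
      unfolding k0_def[symmetric] by simp
    then have n2: "p (n - 1) < a * of_int m"
      using \<open>k0 \<noteq> 0\<close> by (simp add: n_def of_nat_diff algebra_simps)
    \<comment> \<open>The cell of the preceding point starts before \<open>a * of_int m\<close>, so
      the point gained in that slide is still below the right end of the window.\<close>
    obtain i :: int where i: "a * of_int i \<le> p (n - 1)" "p n < a * of_int i + a + c"
      using p[of "n - 1"] unfolding succ_def by auto
    have "a * of_int i < a * of_int m"
      using i n2 by simp
    then have "i + 1 \<le> m"
      using a_pos by simp
    then have "a * of_int (i + 1) \<le> a * of_int m"
      using a_pos by (simp only: mult_le_cancel_left_pos of_int_le_iff)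
    then have n3: "p n < a * of_int m + c"
      using i by (simp add: algebra_simps)
    \<comment> \<open>The cell of the point found starts at or after \<open>a * of_int m\<close>, so
      the next point of the chain is beyond the window.\<close>
    obtain i' :: int where i': "p n < a * of_int i' + a" "a * of_int i' + c \<le> p (n + 1)"
      using p[of n] unfolding succ_def by auto
    have "a * of_int m < a * of_int (i' + 1)"
      using i' n1 by (simp add: algebra_simps)
    then have "m < i' + 1"
      using a_pos by (simp only: mult_less_cancel_left_pos of_int_less_iff)
    then have "a * of_int m \<le> a * of_int i'"
      using a_pos by simp
    then have n4: "a * of_int m + c \<le> p (n + 1)"
      using i' by simp
    obtain k where k: "p n = p 0 + b * of_int k"
      using lattice by blast
    show "\<exists>!k. k \<in> K \<and> a * of_int m \<le> p 0 + b * of_int k \<and> p 0 + b * of_int k < a * of_int m + c"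
    proof (rule ex1I[of _ k])
      show "k \<in> K \<and> a * of_int m \<le> p 0 + b * of_int k \<and> p 0 + b * of_int k < a * of_int m + c"
        using k n1 n3 unfolding K_def by auto
    next
      fix j
      assume j: "j \<in> K \<and> a * of_int m \<le> p 0 + b * of_int j \<and> p 0 + b * of_int j < a * of_int m + c"
      then obtain n' where n': "p n' = p 0 + b * of_int j"
        unfolding K_def by blast
      have "n' = n"
      proof (rule ccontr)
        assume "n' \<noteq> n"
        then have "p n' \<le> p (n - 1) \<or> p (n + 1) \<le> p n'"
          using mono[of n' "n - 1"] mono[of "n + 1" n'] by linarith
        then show False
          using j n' n2 n4 by auto
      qed
      then show "j = k"
        using n' k b_pos by simp
    qed
  qed
  moreover have "0 \<in> K"
    unfolding K_def by (auto intro: exI[of _ 0])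
  ultimately show ?thesis
    unfolding mem_S_iff by blast
qed

text \<open>Forward iterates of \<open>R\<close> and backward iterates of \<open>R'\<close> glue to
  a two-sided \<open>succ\<close> chain through \<open>t\<close> precisely as long as no iterate
  falls into a hole.\<close>

lemma mem_S_iff_orbit: "t \<in> S \<longleftrightarrow> (\<forall>n. (R ^^ n) t \<notin> H \<and> (R' ^^ n) t \<notin> H')"
proof
  assume "t \<in> S"
  then show "\<forall>n. (R ^^ n) t \<notin> H \<and> (R' ^^ n) t \<notin> H'"
    using S_R_funpow S_R'_funpow S_notin_hole S_notin_cohole by blast
next
  assume *: "\<forall>n. (R ^^ n) t \<notin> H \<and> (R' ^^ n) t \<notin> H'"
  define p where "p n = (if n \<ge> 0 then (R ^^ nat n) t else (R' ^^ nat (- n)) t)" for n :: int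
  have "succ (p n) (p (n + 1))" for n
  proof (cases "n \<ge> 0")
    case True
    then show ?thesis
      using succ_R[of "(R ^^ nat n) t"] * by (simp add: p_def nat_add_distrib)
  next
    case False
    define k where "k = nat (- n - 1)"
    have "n = - int (Suc k)"
      using False by (simp add: k_def)
    then have "p n = R' ((R' ^^ k) t)" "p (n + 1) = (R' ^^ k) t"
      by (auto simp: p_def nat_add_distrib)
    then show ?thesis
      using succ_R'[of "(R' ^^ k) t"] * by simp
  qed
  from bi_orbit_mem_S[of p, OF this] show "t \<in> S"
    by (simp add: p_def)
qed

lemma R_mem_S_iff: "t \<notin> H \<Longrightarrow> R t \<in> S \<longleftrightarrow> t \<in> S"
  using S_R S_R' R'_R by metis

subsection \<open>One-sided closedness of the set\<close>

lemma R_right_continuous: "\<exists>e>0. \<forall>y. 0 \<le> y \<and> y < e \<longrightarrow> R (t + y) = R t + y"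
proof (cases "t \<in> H")
  case True
  then obtain k :: int where k: "z + a - b + a * of_int k \<le> t" "t < z + a * of_int k"
    unfolding H_def mem_shiftset_atLeastLessThan by blast
  have "t + y \<in> H" if "0 \<le> y" "y < z + a * of_int k - t" for y
    unfolding H_def mem_shiftset_atLeastLessThan using k that by (intro exI[of _ k]) auto
  then show ?thesis
    using k True by (intro exI[of _ "z + a * of_int k - t"]) (auto simp: R_hole)
next
  case False
  then show ?thesis
  proof (cases rule: not_hole_cases)
    case (left k)
    then have "\<forall>y. 0 \<le> y \<and> y < a * of_int k + z + a - b - t \<longrightarrow> R (t + y) = R t + y"
      using R_left(2)[of k t] R_left(2)[of k "t + _"] by auto
    then show ?thesis
      using left by (intro exI[of _ "a * of_int k + z + a - b - t"]) auto
  next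
    case (right k)
    then have "\<forall>y. 0 \<le> y \<and> y < a * of_int k + a - t \<longrightarrow> R (t + y) = R t + y"
      using R_right(2)[of k t] R_right(2)[of k "t + _"] by auto
    then show ?thesis
      using right by (intro exI[of _ "a * of_int k + a - t"]) auto
  qed
qed

lemma R'_hole: "p \<in> H' \<Longrightarrow> R' p = p"
proof -
  assume "p \<in> H'"
  then have "p \<notin> shiftset {Q + z - a..<Q} a"
    using R'_right(1) by (auto simp: mem_shiftset_atLeastLessThan)
  with \<open>p \<in> H'\<close> show ?thesis
    by (simp add: R'_alt)
qed

lemma R'_right_continuous: "\<exists>e>0. \<forall>y. 0 \<le> y \<and> y < e \<longrightarrow> R' (t + y) = R' t + y"
proof (cases "t \<in> H'")
  case True
  then obtain k :: int where k: "Q + a * of_int k \<le> t" "t < Q + b - a + a * of_int k"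
    unfolding H'_def mem_shiftset_atLeastLessThan by blast
  have "t + y \<in> H'" if "0 \<le> y" "y < Q + b - a + a * of_int k - t" for y
    unfolding H'_def mem_shiftset_atLeastLessThan using k that by (intro exI[of _ k]) auto
  then show ?thesis
    using k True by (intro exI[of _ "Q + b - a + a * of_int k - t"]) (auto simp: R'_hole)
next
  case False
  then show ?thesis
  proof (cases rule: not_cohole_cases)
    case (left k)
    then have "\<forall>y. 0 \<le> y \<and> y < Q + z + a * of_int k - t \<longrightarrow> R' (t + y) = R' t + y"
      using R'_left(2)[of k t] R'_left(2)[of k "t + _"] by auto
    then show ?thesis
      using left by (intro exI[of _ "Q + z + a * of_int k - t"]) auto
  next
    case (right k)
    then have "\<forall>y. 0 \<le> y \<and> y < Q + a * of_int k - t \<longrightarrow> R' (t + y) = R' t + y"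
      using R'_right(2)[of k t] R'_right(2)[of k "t + _"] by auto
    then show ?thesis
      using right by (intro exI[of _ "Q + a * of_int k - t"]) auto
  qed
qed

text \<open>Exclusion from \<open>S\<close> is witnessed by one iterate in a hole. The holes are
  unions of arcs closed on the left and open on the right, and iterates translate short right
  neighbourhoods, so the witness survives small moves to the right.\<close>

lemma complement_right_open:
  assumes "t \<notin> S"
  shows "\<exists>e>0. \<forall>y. 0 \<le> y \<and> y < e \<longrightarrow> t + y \<notin> S"
proof -
  obtain n where "(R ^^ n) t \<in> H \<or> (R' ^^ n) t \<in> H'"
    using assms unfolding mem_S_iff_orbit by blast
  then show ?thesis
  proof
    assume "(R ^^ n) t \<in> H"
    then obtain e where e: "e > 0" "\<And>y. 0 \<le> y \<and> y < e \<Longrightarrow> (R ^^ n) t + y \<in> H"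
      using shiftset_right_open unfolding H_def by metis
    obtain e' where e': "e' > 0" "\<And>y. 0 \<le> y \<and> y < e' \<Longrightarrow> (R ^^ n) (t + y) = (R ^^ n) t + y"
      using funpow_right_continuous[OF R_right_continuous] by metis
    have "t + y \<notin> S" if "0 \<le> y \<and> y < min e e'" for y
      unfolding mem_S_iff_orbit using e(2)[of y] e'(2)[of y] that by (auto intro: exI[of _ n])
    then show ?thesis
      using e e' by (intro exI[of _ "min e e'"]) simp
  next
    assume "(R' ^^ n) t \<in> H'"
    then obtain e where e: "e > 0" "\<And>y. 0 \<le> y \<and> y < e \<Longrightarrow> (R' ^^ n) t + y \<in> H'"
      using shiftset_right_open unfolding H'_def by metis
    obtain e' where e': "e' > 0" "\<And>y. 0 \<le> y \<and> y < e' \<Longrightarrow> (R' ^^ n) (t + y) = (R' ^^ n) t + y"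
      using funpow_right_continuous[OF R'_right_continuous] by metis
    have "t + y \<notin> S" if "0 \<le> y \<and> y < min e e'" for y
      unfolding mem_S_iff_orbit using e(2)[of y] e'(2)[of y] that by (auto intro: exI[of _ n])
    then show ?thesis
      using e e' by (intro exI[of _ "min e e'"]) simp
  qed
qed

text \<open>Periodicity provides points of \<open>S\<close> beyond \<open>t\<close>, and their
  infimum belongs to \<open>S\<close> because the complement is open to the right.\<close>

lemma next_point:
  assumes "S \<noteq> {}"
  obtains v where "v \<in> S" "t \<le> v" "{t..<v} \<inter> S = {}"
proof -
  obtain s where s: "s \<in> S" using assms by blast
  obtain k :: int where k: "a * of_int k \<le> t - s + a" "t - s + a < a * of_int k + a"
    using obtain_floor_cell[OF a_pos] .
  have ne: "{t..} \<inter> S \<noteq> {}"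
  proof -
    have "s + a * of_int k \<in> {t..} \<inter> S"
      using S_shift_imp[OF s, of k] k by simp
    then show ?thesis by blast
  qed
  have bdd: "bdd_below ({t..} \<inter> S)"
    by (rule bdd_belowI[of _ t]) simp
  define v where "v = Inf ({t..} \<inter> S)"
  have low: "v \<le> s" if "s \<in> S" "t \<le> s" for s
    unfolding v_def using that by (intro cInf_lower bdd) simp
  have "t \<le> v"
    unfolding v_def using ne by (intro cInf_greatest) auto
  moreover have "v \<in> S"
  proof (rule ccontr)
    assume "v \<notin> S"
    then obtain e where e: "e > 0" "\<And>y. 0 \<le> y \<and> y < e \<Longrightarrow> v + y \<notin> S"
      using complement_right_open by blast
    obtain s where "s \<in> S" "t \<le> s" "s < v + e"
      using cInf_lessD[OF ne, of "v + e"] e(1) unfolding v_def by auto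
    then show False
      using e(2)[of "s - v"] low[of s] by simp
  qed
  moreover have "{t..<v} \<inter> S = {}"
    using low by force
  ultimately show ?thesis
    using that by blast
qed

subsection \<open>Gaps\<close>

definition acong :: "real \<Rightarrow> real \<Rightarrow> bool" where
  "acong u v \<longleftrightarrow> (\<exists>k::int. u = v + a * of_int k)"

text \<open>Only a lower bound for the length of the gap left of \<open>v\<close>; it holds
  vacuously for \<open>e = 0\<close>.\<close>

definition gap :: "real \<Rightarrow> real \<Rightarrow> bool" where
  "gap v e \<longleftrightarrow> {v - e..<v} \<inter> S = {}"

definition first :: "real \<Rightarrow> real \<Rightarrow> bool" where
  "first t v \<longleftrightarrow> v \<in> S \<and> t \<le> v \<and> {t..<v} \<inter> S = {}"

lemma acong_refl: "acong u u"
  unfolding acong_def by (intro exI[of _ 0]) simp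

lemma acong_sym: "acong u v \<Longrightarrow> acong v u"
proof -
  assume "acong u v"
  then obtain k :: int where "u = v + a * of_int k"
    unfolding acong_def by blast
  then show ?thesis
    unfolding acong_def by (intro exI[of _ "- k"]) simp
qed

lemma acong_trans: "acong u v \<Longrightarrow> acong v w \<Longrightarrow> acong u w"
proof -
  assume "acong u v" "acong v w"
  then obtain k j :: int where "u = v + a * of_int k" "v = w + a * of_int j"
    unfolding acong_def by blast
  then show ?thesis
    unfolding acong_def by (intro exI[of _ "j + k"]) (simp add: algebra_simps)
qed

lemma acong_shift: "acong (u + a * of_int k) u"
  unfolding acong_def by blast

lemma S_acong: "acong u v \<Longrightarrow> u \<in> S \<longleftrightarrow> v \<in> S"
  unfolding acong_def by (auto simp: S_shift)

lemma gapD: "gap v e \<Longrightarrow> v - e \<le> s \<Longrightarrow> s < v \<Longrightarrow> s \<notin> S"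
  unfolding gap_def by (auto simp: disjoint_iff)

lemma gap_acong:
  assumes "acong u v" "gap v e"
  shows "gap u e"
proof -
  obtain k :: int where k: "u = v + a * of_int k"
    using assms(1) unfolding acong_def by blast
  show ?thesis
    unfolding gap_def disjoint_iff
  proof (intro allI impI)
    fix s assume "s \<in> {u - e..<u}"
    then have "s + a * of_int (- k) \<notin> S"
      by (intro gapD[OF assms(2)]) (auto simp: k)
    then show "s \<notin> S"
      unfolding S_shift .
  qed
qed

lemma firstD: "first t v \<Longrightarrow> t \<le> s \<Longrightarrow> s < v \<Longrightarrow> s \<notin> S"
  unfolding first_def by (auto simp: disjoint_iff)

lemma first_gap: "first t v \<Longrightarrow> gap v (v - t)"
  unfolding first_def gap_def by simp

lemma gap_first: "v \<in> S \<Longrightarrow> gap v e \<Longrightarrow> v - e \<le> t \<Longrightarrow> t \<le> v \<Longrightarrow> first t v"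
  unfolding first_def gap_def by (force simp: disjoint_iff)

lemma first_shift:
  assumes "first t v"
  shows "first (t + a * of_int k) (v + a * of_int k)"
  unfolding first_def disjoint_iff
proof (intro conjI allI impI)
  show "v + a * of_int k \<in> S" "t + a * of_int k \<le> v + a * of_int k"
    using assms unfolding first_def by (auto simp: S_shift)
  fix s assume "s \<in> {t + a * of_int k..<v + a * of_int k}"
  then have "s + a * of_int (- k) \<notin> S"
    by (intro firstD[OF assms]) auto
  then show "s \<notin> S"
    unfolding S_shift .
qed

lemma first_unique: "first t u \<Longrightarrow> first t v \<Longrightarrow> u = v"
  using firstD[of t u v] firstD[of t v u] unfolding first_def by linarith

lemma first_acong:
  assumes "first t v" "first (t + a * of_int k) u"
  shows "acong u v"
  using first_unique[OF assms(2) first_shift[OF assms(1)]] acong_shift by simp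

lemma first_less:
  assumes "first t v"
  shows "v < t + a"
proof (rule ccontr)
  assume "\<not> v < t + a"
  then have "v + a * of_int (- 1) \<notin> S"
    using a_pos by (intro firstD[OF assms]) auto
  then show False
    using assms unfolding first_def S_shift by blast
qed

text \<open>The irrationality of \<open>a / b\<close> enters here.\<close>

lemma incommensurable:
  assumes "b * of_int N = a * of_int k" "0 < N"
  shows False
proof -
  have "k \<noteq> 0"
    using assms b_pos by auto
  then have "a / b = of_int N / of_int k"
    using assms b_pos by (simp add: field_simps)
  then show False
    using irrational by simp
qed

lemma S_orbit_step:
  assumes "v \<in> S"
  shows "\<exists>N::int. 0 < N \<and> (R ^^ Suc n) v = v + b * of_int N"
proof (induction n)
  case 0
  then show ?case
    using R_step[OF S_notin_hole[OF assms]] by auto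
next
  case (Suc n)
  then obtain N :: int where N: "0 < N" "(R ^^ Suc n) v = v + b * of_int N" by blast
  obtain j :: int where "0 < j" "R ((R ^^ Suc n) v) = (R ^^ Suc n) v + b * of_int j"
    using R_step[OF S_notin_hole[OF S_R_funpow[OF assms]]] .
  with N show ?case
    by (intro exI[of _ "N + j"]) (simp add: algebra_simps)
qed

text \<open>Between two different times the orbit advances by a positive multiple of
  \<open>b\<close>, which is never a multiple of \<open>a\<close>. Orbits in \<open>S\<close> are
  therefore infinite modulo \<open>a\<close>.\<close>

lemma S_orbit_distinct:
  assumes "v \<in> S" "acong ((R ^^ i) v) ((R ^^ j) v)"
  shows "i = j"
proof -
  have "\<not> acong ((R ^^ j) v) ((R ^^ i) v)" if "i < j" for i j
  proof
    assume "acong ((R ^^ j) v) ((R ^^ i) v)"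
    then obtain k :: int where k: "(R ^^ j) v = (R ^^ i) v + a * of_int k"
      unfolding acong_def by blast
    obtain n where n: "j = Suc n + i"
      using less_imp_Suc_add[OF \<open>i < j\<close>] by auto
    obtain N :: int where N: "0 < N" "(R ^^ Suc n) ((R ^^ i) v) = (R ^^ i) v + b * of_int N"
      using S_orbit_step[OF S_R_funpow[OF assms(1)]] by blast
    have "b * of_int N = a * of_int k"
      using N(2) k unfolding n by (simp add: funpow_add)
    then show False
      using incommensurable N(1) by blast
  qed
  from this[of i j] this[of j i] show ?thesis
    using assms(2) acong_sym[OF assms(2)] by (cases i j rule: linorder_cases) auto
qed

lemma S_R_cancel:
  assumes "u \<in> S" "v \<in> S" "acong ((R ^^ n) u) ((R ^^ n) v)"
  shows "acong u v"
proof -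
  obtain k :: int where k: "(R ^^ n) u = (R ^^ n) (v + a * of_int k)"
    using assms(3) unfolding acong_def R_funpow_shift by blast
  have "u = w" if "w \<in> S" "(R ^^ n) u = (R ^^ n) w" for w
    using that(2)
  proof (induction n)
    case (Suc n)
    then have "(R ^^ n) u = (R ^^ n) w"
      using R'_R[OF S_notin_hole[OF S_R_funpow[OF assms(1)]]]
        R'_R[OF S_notin_hole[OF S_R_funpow[OF that(1)]]]
      by (metis comp_apply funpow.simps(2))
    then show ?case by (rule Suc.IH)
  qed simp
  then have "u = v + a * of_int k"
    using k assms(2) S_shift by blast
  then show ?thesis
    by (simp add: acong_shift)
qed

text \<open>A packing bound on the circle of length \<open>a\<close>: each of the points owns an arc
  of length \<open>e\<close> to its left that contains none of the others.\<close>

lemma card_gaps_le: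
  assumes "finite I" "0 < e"
    and S: "\<And>i. i \<in> I \<Longrightarrow> f i \<in> S" and gap: "\<And>i. i \<in> I \<Longrightarrow> gap (f i) e"
    and distinct: "\<And>i j. i \<in> I \<Longrightarrow> j \<in> I \<Longrightarrow> acong (f i) (f j) \<Longrightarrow> i = j"
  shows "int (card I) \<le> \<lfloor>a / e\<rfloor>"
proof (cases "I = {}")
  case True
  then show ?thesis
    using a_pos \<open>0 < e\<close> by simp
next
  case False
  define g where "g i = f i + a * of_int (- \<lfloor>f i / a\<rfloor>)" for i
  have g_cong: "acong (g i) (f i)" for i
    unfolding g_def by (rule acong_shift)
  have g_S: "g i \<in> S" if "i \<in> I" for i
    using S_acong[OF g_cong] S that by blast
  have g_gap: "gap (g i) e" if "i \<in> I" for i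
    using gap_acong[OF g_cong gap[OF that]] .
  have g_range: "0 \<le> g i" "g i < a" for i
    using floor_divide_lower[OF a_pos, of "f i"] floor_divide_upper[OF a_pos, of "f i"]
    by (simp_all add: g_def algebra_simps)
  have g_inj: "i = j" if "i \<in> I" "j \<in> I" "g i = g j" for i j
    using distinct[OF that(1,2)] that(3) acong_sym acong_trans g_cong by metis
  define m where "m = Min (g ` I)"
  have m_le: "m \<le> g i" if "i \<in> I" for i
    unfolding m_def using \<open>finite I\<close> that by simp
  have "m \<in> g ` I"
    unfolding m_def using \<open>finite I\<close> False by simp
  then obtain i0 where i0: "i0 \<in> I" "m = g i0" by blast
  \<comment> \<open>Wrap-around: \<open>m + a\<close> is the smallest representative once more, and
    its left gap bounds all the others from above.\<close>
  have upper: "g i < m + a - e" if "i \<in> I" for i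
  proof (rule ccontr)
    assume "\<not> g i < m + a - e"
    moreover have "gap (m + a * of_int 1) e"
      using gap_acong[OF acong_shift g_gap[OF i0(1)]] i0(2) by blast
    moreover have "g i < m + a"
      using g_range[of i] g_range[of i0] i0(2) by simp
    ultimately have "g i \<notin> S"
      using gapD[of "m + a" e "g i"] by simp
    then show False
      using g_S that by blast
  qed
  have sep: "g i < g j - e" if "i \<in> I" "j \<in> I" "g i < g j" for i j
    using gapD[OF g_gap[OF that(2)], of "g i"] g_S[OF that(1)] that(3) not_less by blast
  \<comment> \<open>Bins of length \<open>e\<close> counted from \<open>m\<close>. By
    \<open>sep\<close> different representatives fall into different bins, and by
    \<open>upper\<close> only \<open>\<lfloor>a / e\<rfloor>\<close> bins can occur.\<close>
  define h where "h i = \<lfloor>(g i - m) / e\<rfloor>" for i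
  have h_less: "h i < h j" if "i \<in> I" "j \<in> I" "g i < g j" for i j
  proof -
    have "(g i - m) / e + 1 = (g i - m + e) / e"
      using \<open>0 < e\<close> by (simp add: add_divide_distrib)
    also have "\<dots> \<le> (g j - m) / e"
      using sep[OF that] \<open>0 < e\<close> by (intro divide_right_mono) auto
    finally have "(g i - m) / e + 1 \<le> (g j - m) / e" .
    then have "\<lfloor>(g i - m) / e + 1\<rfloor> \<le> h j"
      unfolding h_def by (rule floor_mono)
    then show ?thesis
      by (simp add: h_def)
  qed
  have "inj_on h I"
  proof (rule inj_onI)
    fix i j assume ij: "i \<in> I" "j \<in> I" "h i = h j"
    then have "g i = g j"
      using h_less[of i j] h_less[of j i] by (cases "g i" "g j" rule: linorder_cases) auto
    then show "i = j"
      using g_inj ij by blast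
  qed
  moreover have "h ` I \<subseteq> {0..\<lfloor>a / e\<rfloor> - 1}"
  proof
    fix x assume "x \<in> h ` I"
    then obtain i where i: "i \<in> I" "x = h i" by blast
    have "(g i - m) / e \<le> (a - e) / e"
      using upper[OF i(1)] \<open>0 < e\<close> by (intro divide_right_mono) auto
    also have "\<dots> = a / e - 1"
      using \<open>0 < e\<close> by (simp add: diff_divide_distrib)
    finally have "(g i - m) / e \<le> a / e - 1" .
    then have "h i \<le> \<lfloor>a / e - 1\<rfloor>"
      unfolding h_def by (rule floor_mono)
    moreover have "0 \<le> h i"
      using m_le[OF i(1)] \<open>0 < e\<close> by (simp add: h_def)
    ultimately show "x \<in> {0..\<lfloor>a / e\<rfloor> - 1}"
      using i(2) by simp
  qed
  ultimately have "card I \<le> card {0..\<lfloor>a / e\<rfloor> - 1}"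
    by (intro card_inj_on_le) auto
  also have "\<dots> = nat \<lfloor>a / e\<rfloor>"
    by simp
  finally show ?thesis
    using a_pos \<open>0 < e\<close> by (simp add: le_nat_iff)
qed

text \<open>An orbit supplies arbitrarily many incongruent points, more than the packing bound
  admits.\<close>

lemma no_persistent_gap:
  assumes "v \<in> S" "0 < e" "\<And>n. N \<le> n \<Longrightarrow> gap ((R ^^ n) v) e"
  shows False
proof -
  define M where "M = Suc (nat \<lfloor>a / e\<rfloor>)"
  have "int (card {N..<N + M}) \<le> \<lfloor>a / e\<rfloor>"
  proof (rule card_gaps_le[where f = "\<lambda>n. (R ^^ n) v"])
    show "i = j" if "acong ((R ^^ i) v) ((R ^^ j) v)" for i j
      using S_orbit_distinct[OF assms(1) that] .
  qed (simp_all add: assms S_R_funpow)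
  moreover have "0 \<le> \<lfloor>a / e\<rfloor>"
    using a_pos \<open>0 < e\<close> by simp
  ultimately show False
    by (simp add: M_def)
qed

lemma cohole_notin_S:
  assumes "Q + a * of_int k \<le> s" "s < Q + b - a + a * of_int k"
  shows "s \<notin> S"
proof -
  have "s \<in> H'"
    unfolding H'_def mem_shiftset_atLeastLessThan using assms by blast
  then show ?thesis
    using S_notin_cohole by blast
qed

lemma hole_notin_S:
  assumes "z + a - b + a * of_int k \<le> s" "s < z + a * of_int k"
  shows "s \<notin> S"
proof -
  have "s \<in> H"
    unfolding H_def mem_shiftset_atLeastLessThan using assms by blast
  then show ?thesis
    using S_notin_hole by blast
qed

lemma R_left_mem_S:
  assumes "a * of_int k \<le> u" "u < a * of_int k + z + a - b"
  shows "u + Q + b \<in> S \<longleftrightarrow> u \<in> S"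
  using R_mem_S_iff R_left[OF assms] by metis

lemma R_right_mem_S:
  assumes "a * of_int k + z \<le> u" "u < a * of_int k + a"
  shows "u + Q \<in> S \<longleftrightarrow> u \<in> S"
  using R_mem_S_iff R_right[OF assms] by metis

lemma shiftset_translate_acong:
  assumes "acong u v"
  shows "shiftset ((\<lambda>y. u + y) ` A) a = shiftset ((\<lambda>y. v + y) ` A) a"
proof -
  have "shiftset ((\<lambda>y. u + y) ` A) a \<subseteq> shiftset ((\<lambda>y. v + y) ` A) a" if "acong u v" for u v
  proof
    fix p assume "p \<in> shiftset ((\<lambda>y. u + y) ` A) a"
    then obtain y and k :: int where "y \<in> A" "p = u + y + a * of_int k"
      unfolding mem_shiftset_translate by blast
    moreover obtain j :: int where "u = v + a * of_int j"
      using \<open>acong u v\<close> unfolding acong_def by blast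
    ultimately have "y \<in> A" "p = v + y + a * of_int (j + k)"
      by (simp_all add: algebra_simps)
    then show "p \<in> shiftset ((\<lambda>y. v + y) ` A) a"
      unfolding mem_shiftset_translate by blast
  qed
  from this[OF assms] this[OF acong_sym[OF assms]] show ?thesis by blast
qed

lemma H'_shift: "p + a * of_int k \<in> H' \<longleftrightarrow> p \<in> H'"
proof -
  have "p + a * of_int k \<in> H'" if "p \<in> H'" for p and k :: int
    using that unfolding H'_def mem_shiftset_iff
    by (auto simp: algebra_simps intro: exI[of _ "_ + k"])
  from this[of p k] this[of "p + a * of_int k" "- k"] show ?thesis by auto
qed

lemma R'_shift: "R' (p + a * of_int k) = R' p + a * of_int k"
proof (cases "p \<in> H'")
  case True
  then show ?thesis by (simp add: R'_hole H'_shift)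
next
  case False
  have "succ (R' p + a * of_int k) (p + a * of_int k)"
    using succ_R[of "R' p + a * of_int k"] R'_notin_hole[OF False] R_R'[OF False]
    by (simp add: H_shift R_shift)
  then show ?thesis
    by (rule succD(4))
qed

lemma R'_funpow_shift: "(R' ^^ n) (p + a * of_int k) = (R' ^^ n) p + a * of_int k"
  by (induction n) (simp_all add: R'_shift)

end

subsection \<open>Transport of gaps\<close>

text \<open>At \<open>0\<close> the displacement of \<open>R\<close> rises from \<open>Q\<close> to
  \<open>Q + b\<close>, and after the hole it is back at \<open>Q\<close> from \<open>z\<close> on.
  The first points of \<open>S\<close> after these two places are eventually shown to be
  \<open>0\<close> and \<open>z\<close> themselves.\<close>

locale abc_first = abc_params +
  fixes v0 vH :: real
  assumes v0: "first 0 v0" and vH: "first z vH"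
begin

lemma v0_mem: "v0 \<in> S"
  using v0 unfolding first_def by simp

text \<open>If the gap met a multiple of \<open>a\<close>, or \<open>z\<close> modulo
  \<open>a\<close>, then \<open>v\<close> would be the first point of \<open>S\<close> after it and
  so congruent to \<open>v0\<close> or \<open>vH\<close>. Otherwise gap and endpoint lie in a single
  piece of \<open>R\<close>.\<close>

lemma gap_translate:
  assumes "v \<in> S" "gap v e" "0 \<le> e" "\<not> acong v v0" "\<not> acong v vH" "0 \<le> y" "y \<le> e"
  shows "v - y \<notin> H" "R (v - y) = R v - y"
proof -
  obtain k :: int where k: "a * of_int k \<le> v" "v < a * of_int k + a"
    using obtain_floor_cell[OF a_pos] .
  have 0: "a * of_int k < v - e"
  proof (rule ccontr)
    assume "\<not> a * of_int k < v - e"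
    then have "first (0 + a * of_int k) v"
      using gap_first[OF assms(1,2)] k by simp
    then show False
      using first_acong[OF v0] assms by blast
  qed
  have 1: "v < a * of_int k + z \<or> a * of_int k + z < v - e"
  proof (rule ccontr)
    assume "\<not> ?thesis"
    then have "first (z + a * of_int k) v"
      using gap_first[OF assms(1,2)] by simp
    then show False
      using first_acong[OF vH] assms by blast
  qed
  have "v - y \<notin> H \<and> R (v - y) = R v - y"
    using 1
  proof
    assume "v < a * of_int k + z"
    then have "v < a * of_int k + z + a - b"
      using hole_notin_S[of k v] \<open>v \<in> S\<close> by force
    then show ?thesis
      using R_left[of k v] R_left[of k "v - y"] k 0 assms by simp
  next
    assume "a * of_int k + z < v - e"
    then show ?thesis
      using R_right[of k v] R_right[of k "v - y"] k assms by simp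
  qed
  then show "v - y \<notin> H" "R (v - y) = R v - y" by auto
qed

lemma gap_R:
  assumes "v \<in> S" "gap v e" "0 \<le> e" "\<not> acong v v0" "\<not> acong v vH"
  shows "gap (R v) e"
  unfolding gap_def disjoint_iff
proof (intro allI impI)
  fix s assume s: "s \<in> {R v - e..<R v}"
  have "v - (R v - s) \<notin> H" "R (v - (R v - s)) = s"
    using gap_translate[OF assms, of "R v - s"] s by auto
  moreover have "v - (R v - s) \<notin> S"
    using s by (intro gapD[OF assms(2)]) auto
  ultimately show "s \<notin> S"
    using R_mem_S_iff by metis
qed

text \<open>The two sides of the multiple of \<open>a\<close> below \<open>v\<close> are displaced
  by \<open>Q\<close> and \<open>Q + b\<close>, so modulo \<open>a\<close> their images are pushed
  apart by \<open>b - a\<close>. A copy of \<open>H'\<close>, which misses \<open>S\<close>, fills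
  the space.\<close>

lemma gap_R_v0:
  assumes "acong v v0" "\<not> acong v vH" "gap v e" "0 \<le> e"
  shows "gap (R v) (e + (b - a))"
proof -
  obtain k :: int where "v = v0 + a * of_int k"
    using assms(1) unfolding acong_def by blast
  then have first: "first (a * of_int k) v"
    using first_shift[OF v0, of k] by simp
  then have v: "v \<in> S" "a * of_int k \<le> v"
    unfolding first_def by auto
  \<comment> \<open>The gap is enlarged where necessary so that it reaches down to
    \<open>a * of_int k\<close>.\<close>
  define e' where "e' = max e (v - a * of_int k)"
  have gap: "gap v e'"
    using assms(3) first_gap[OF first] unfolding e'_def by (simp add: max_def)
  have "e' \<ge> v - a * of_int k" "e' \<ge> e"
    by (simp_all add: e'_def)
  have avoid: "v < z + a * of_int j \<or> z + a * of_int j < v - e'" for j :: int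
  proof (rule ccontr)
    assume "\<not> ?thesis"
    then have "first (z + a * of_int j) v"
      using gap_first[OF v(1) gap] by simp
    then show False
      using first_acong[OF vH] assms by blast
  qed
  have "v < z + a * of_int k"
    using avoid[of k] \<open>e' \<ge> v - a * of_int k\<close> params by auto
  then have v_less: "v < a * of_int k + z + a - b"
    using hole_notin_S[of k v] v(1) by force
  have e'_less: "a * of_int (k - 1) + z < v - e'"
    using avoid[of "k - 1"] v(2) params by (auto simp: algebra_simps)
  have Rv: "R v = v + Q + b"
    using R_left(2)[OF v(2) v_less] .
  show ?thesis
    unfolding gap_def disjoint_iff
  proof (intro allI impI)
    fix s assume "s \<in> {R v - (e + (b - a))..<R v}"
    then have s: "v + Q + a - e \<le> s" "s < v + Q + b"
      unfolding Rv by auto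
    \<comment> \<open>In order: the image of the gap above \<open>a * of_int k\<close>, a copy of
      \<open>H'\<close>, and modulo \<open>a\<close> the image of the gap below
      \<open>a * of_int k\<close>.\<close>
    consider "a * of_int k + Q + b \<le> s" | "a * of_int k + Q + a \<le> s" "s < a * of_int k + Q + b"
      | "s < a * of_int k + Q + a" by linarith
    then show "s \<notin> S"
    proof cases
      case 1
      then have "s - Q - b \<notin> S"
        using s by (intro firstD[OF first]) auto
      then show ?thesis
        using R_left_mem_S[of k "s - Q - b"] 1 s v_less by simp
    next
      case 2
      then show ?thesis
        using cohole_notin_S[of "k + 1" s] by (simp add: algebra_simps)
    next
      case 3
      have u: "v - e' \<le> s - Q - a"
        using s \<open>e' \<ge> e\<close> by simp
      have "s - Q - a \<notin> S"
        using u 3 v(2) by (intro gapD[OF gap]) auto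
      moreover have "a * of_int (k - 1) + z \<le> s - Q - a" "s - Q - a < a * of_int (k - 1) + a"
        using e'_less u 3 by (auto simp: algebra_simps)
      ultimately have "s + a * of_int (- 1) \<notin> S"
        using R_right_mem_S[of "k - 1" "s - Q - a"] by simp
      then show ?thesis
        unfolding S_shift .
    qed
  qed
qed

lemma first_z_gap:
  assumes "first (z + a * of_int k) v"
  shows "gap v (v - z - a * of_int k + (b - a))"
  unfolding gap_def disjoint_iff
proof (intro allI impI)
  fix s assume "s \<in> {v - (v - z - a * of_int k + (b - a))..<v}"
  then show "s \<notin> S"
    using hole_notin_S[of k s] firstD[OF assms, of s] by force
qed

text \<open>The opposite effect: \<open>R\<close> moves the two sides of the hole by
  \<open>Q\<close> and \<open>Q + b\<close>, so modulo \<open>a\<close> their images become adjacent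
  and the gap loses the length of the hole.\<close>

lemma gap_R_vH:
  assumes "acong v vH" "\<not> acong v v0" "gap v (e + (b - a))" "0 \<le> e"
  shows "gap (R v) e"
proof -
  obtain k :: int where "v = vH + a * of_int k"
    using assms(1) unfolding acong_def by blast
  then have first: "first (z + a * of_int k) v"
    using first_shift[OF vH, of k] by simp
  then have v: "v \<in> S" "z + a * of_int k \<le> v"
    unfolding first_def by auto
  define e' where "e' = max e (v - z - a * of_int k)"
  have gap: "gap v (e' + (b - a))"
    using assms(3) first_z_gap[OF first] unfolding e'_def by (simp add: max_def)
  have e': "e' \<ge> v - z - a * of_int k" "e' \<ge> e"
    by (simp_all add: e'_def)
  have avoid: "v < a * of_int j \<or> a * of_int j < v - (e' + (b - a))" for j :: int
  proof (rule ccontr)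
    assume "\<not> ?thesis"
    then have "first (0 + a * of_int j) v"
      using gap_first[OF v(1) gap] by simp
    then show False
      using first_acong[OF v0] assms by blast
  qed
  have v_less: "v < a * of_int k + a"
    using avoid[of "k + 1"] e' params by (auto simp: algebra_simps)
  have e'_less: "a * of_int k < v - (e' + (b - a))"
    using avoid[of k] v(2) params by auto
  have Rv: "R v = v + Q"
    using R_right(2)[of k v] v v_less by simp
  show ?thesis
    unfolding gap_def disjoint_iff
  proof (intro allI impI)
    fix s assume "s \<in> {R v - e..<R v}"
    then have s: "v + Q - e \<le> s" "s < v + Q"
      unfolding Rv by auto
    show "s \<notin> S"
    proof (cases "a * of_int k + z + Q \<le> s")
      case True
      then have "s - Q \<notin> S"
        using s by (intro firstD[OF first]) auto
      then show ?thesis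
        using R_right_mem_S[of k "s - Q"] True s v_less by simp
    next
      case False
      \<comment> \<open>Here \<open>s\<close> comes from the left of the hole, where the
        displacement is \<open>Q + b\<close>; the translate \<open>s + a\<close> has preimage
        \<open>s + a - Q - b\<close>.\<close>
      have u: "v - (e' + (b - a)) \<le> s + a - Q - b"
        using s e' by simp
      have "s + a - Q - b \<notin> S"
        using u False v(2) a_less_b by (intro gapD[OF gap]) auto
      moreover have "a * of_int k \<le> s + a - Q - b" "s + a - Q - b < a * of_int k + z + a - b"
        using e'_less u False by auto
      ultimately have "s + a * of_int 1 \<notin> S"
        using R_left_mem_S[of k "s + a - Q - b"] by simp
      then show ?thesis
        unfolding S_shift .
    qed
  qed
qed

text \<open>The case to be refuted next. If \<open>v\<close> lies before the hole, its image has a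
  copy of \<open>H'\<close> on the left. If it lies after, the piece of the cell before the hole is
  free, and its length \<open>z - (b - a)\<close> is positive.\<close>

lemma gap_R_v0_vH:
  assumes "acong v v0" "acong v vH"
  shows "\<exists>e>0. gap (R v) e"
proof -
  obtain k :: int where "v = v0 + a * of_int k"
    using assms(1) unfolding acong_def by blast
  then have first: "first (a * of_int k) v"
    using first_shift[OF v0, of k] by simp
  then have v: "v \<in> S" "a * of_int k \<le> v" "v < a * of_int k + a"
    using first_less[OF first] unfolding first_def by auto
  show ?thesis
  proof (cases "v < a * of_int k + z")
    case True
    then have v_less: "v < a * of_int k + z + a - b"
      using hole_notin_S[of k v] v(1) by force
    have "s \<notin> S" if "s \<in> {v + Q + b - (b - a)..<v + Q + b}" for s
    proof (cases "a * of_int k + Q + b \<le> s")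
      case True
      then have "s - Q - b \<notin> S"
        using that by (intro firstD[OF first]) auto
      then show ?thesis
        using R_left_mem_S[of k "s - Q - b"] True that v_less by simp
    next
      case False
      then show ?thesis
        using cohole_notin_S[of "k + 1" s] v that by (simp add: algebra_simps)
    qed
    then have "gap (R v) (b - a)"
      unfolding gap_def disjoint_iff R_left(2)[OF v(2) v_less] by blast
    then show ?thesis
      using a_less_b by (intro exI[of _ "b - a"]) simp
  next
    case False
    have "s \<notin> S" if "s \<in> {v + Q - (z - (b - a))..<v + Q}" for s
    proof (cases "a * of_int k + z + Q \<le> s")
      case True
      then have "s - Q \<notin> S"
        using that params by (intro firstD[OF first]) auto
      then show ?thesis
        using R_right_mem_S[of k "s - Q"] True that v by simp
    next
      case s: False
      have u: "a * of_int k \<le> s + a - Q - b" "s + a - Q - b < a * of_int k + z + a - b"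
        using that s False by auto
      then have "s + a - Q - b \<notin> S"
        using False a_less_b by (intro firstD[OF first]) auto
      then have "s + a * of_int 1 \<notin> S"
        using R_left_mem_S[OF u] by simp
      then show ?thesis
        unfolding S_shift .
    qed
    moreover have "R v = v + Q"
      using R_right(2)[of k v] False v by simp
    ultimately have "gap (R v) (z - (b - a))"
      unfolding gap_def disjoint_iff by auto
    then show ?thesis
      using c0_lower by (intro exI[of _ "z - (b - a)"]) simp
  qed
qed

lemma gap_R_funpow:
  assumes "v \<in> S" "gap ((R ^^ m) v) e" "0 \<le> e" "m \<le> n"
    and "\<And>i. m \<le> i \<Longrightarrow> i < n \<Longrightarrow> \<not> acong ((R ^^ i) v) v0 \<and> \<not> acong ((R ^^ i) v) vH"
  shows "gap ((R ^^ n) v) e"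
  using assms(4,5)
proof (induction n rule: dec_induct)
  case base
  show ?case by (rule assms(2))
next
  case (step n)
  then have "gap ((R ^^ n) v) e" by simp
  with step show ?case
    using gap_R[of "(R ^^ n) v" e] S_R_funpow[OF assms(1)] assms(3) by simp
qed

section \<open>The orbit from \<open>v0\<close> to \<open>vH\<close>\<close>

lemma orbit_v0_avoids_v0: "0 < n \<Longrightarrow> \<not> acong ((R ^^ n) v0) v0"
  using S_orbit_distinct[OF v0_mem, of n 0] by auto

text \<open>Otherwise the orbit meets neither point again after its first step, and the gap created
  there persists.\<close>

lemma v0_vH_distinct: "\<not> acong v0 vH"
proof
  assume cong: "acong v0 vH"
  obtain e where e: "0 < e" "gap (R v0) e"
    using gap_R_v0_vH[OF acong_refl cong] by blast
  have "gap ((R ^^ n) v0) e" if "1 \<le> n" for n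
  proof (rule gap_R_funpow[OF v0_mem, of 1])
    show "\<not> acong ((R ^^ i) v0) v0 \<and> \<not> acong ((R ^^ i) v0) vH" if "1 \<le> i" for i
      using orbit_v0_avoids_v0[of i] acong_trans[OF _ acong_sym[OF cong], of "(R ^^ i) v0"] that
      by auto
  qed (use e that in simp_all)
  then show False
    using no_persistent_gap[OF v0_mem e(1)] by blast
qed

lemma gap_R_orbit_v0:
  assumes "gap v0 e" "0 \<le> e" "\<And>i. 1 \<le> i \<Longrightarrow> i < n \<Longrightarrow> \<not> acong ((R ^^ i) v0) vH" "1 \<le> n"
  shows "gap ((R ^^ n) v0) (e + (b - a))"
proof (rule gap_R_funpow[OF v0_mem, of 1])
  show "gap ((R ^^ 1) v0) (e + (b - a))"
    using gap_R_v0[OF acong_refl v0_vH_distinct assms(1,2)] by simp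
  show "\<not> acong ((R ^^ i) v0) v0 \<and> \<not> acong ((R ^^ i) v0) vH" if "1 \<le> i" "i < n" for i
    using orbit_v0_avoids_v0[of i] assms(3) that by simp
qed (use assms a_less_b in simp_all)

text \<open>Otherwise the length \<open>b - a\<close> gained at \<open>v0\<close> is never given
  back.\<close>

lemma orbit_v0_reaches_vH: "\<exists>n. acong ((R ^^ Suc n) v0) vH"
proof (rule ccontr)
  assume "\<not> ?thesis"
  then have "\<not> acong ((R ^^ i) v0) vH" if "1 \<le> i" for i
    using that by (cases i) auto
  then have "gap ((R ^^ n) v0) (0 + (b - a))" if "1 \<le> n" for n
    using that by (intro gap_R_orbit_v0) (auto simp: gap_def)
  then show False
    using no_persistent_gap[OF v0_mem, of "b - a" 1] a_less_b by simp
qed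

text \<open>One less than the hitting time, since counting starts at \<open>R v0\<close>, which
  turns out to be the right end of \<open>H'\<close> modulo \<open>a\<close>. The choice is
  unambiguous by \<open>orbit_v0_vH_iff\<close>.\<close>

definition D :: nat where "D = (SOME n. acong ((R ^^ Suc n) v0) vH)"

lemma orbit_D: "acong ((R ^^ Suc D) v0) vH"
  using someI_ex[OF orbit_v0_reaches_vH] unfolding D_def .

lemma orbit_v0_vH_iff: "acong ((R ^^ n) v0) vH \<longleftrightarrow> n = Suc D"
proof
  assume "acong ((R ^^ n) v0) vH"
  then have "acong ((R ^^ n) v0) ((R ^^ Suc D) v0)"
    using acong_sym[OF orbit_D] by (rule acong_trans)
  then show "n = Suc D"
    by (rule S_orbit_distinct[OF v0_mem])
qed (use orbit_D in simp)

text \<open>The excess over \<open>b - a\<close> survives the passage through \<open>vH\<close> and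
  then persists, because the orbit of \<open>v0\<close> meets neither special point again.\<close>

lemma no_gap_vH:
  assumes "0 < e" "gap vH (e + (b - a))"
  shows False
proof -
  have "gap (R ((R ^^ Suc D) v0)) e"
    using gap_acong[OF orbit_D assms(2)] orbit_v0_avoids_v0[of "Suc D"] orbit_D assms(1)
    by (intro gap_R_vH) auto
  then have start: "gap ((R ^^ Suc (Suc D)) v0) e" by simp
  have "gap ((R ^^ n) v0) e" if "Suc (Suc D) \<le> n" for n
  proof (rule gap_R_funpow[OF v0_mem start _ that])
    show "\<not> acong ((R ^^ i) v0) v0 \<and> \<not> acong ((R ^^ i) v0) vH" if "Suc (Suc D) \<le> i" for i
      using orbit_v0_avoids_v0[of i] orbit_v0_vH_iff[of i] that by simp
  qed (use \<open>0 < e\<close> in simp)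
  then show False
    using no_persistent_gap[OF v0_mem assms(1)] by blast
qed

text \<open>Such a gap would arrive at \<open>vH\<close> enlarged by \<open>b - a\<close>.\<close>

lemma no_gap_v0:
  assumes "0 < e" "gap v0 e"
  shows False
proof -
  have "gap ((R ^^ Suc D) v0) (e + (b - a))"
    using assms orbit_v0_vH_iff by (intro gap_R_orbit_v0) auto
  then show False
    using gap_acong[OF acong_sym[OF orbit_D]] no_gap_vH[OF assms(1)] by blast
qed

lemma v0_eq: "v0 = 0"
proof (rule ccontr)
  assume "v0 \<noteq> 0"
  then have "0 < v0"
    using v0 unfolding first_def by simp
  then show False
    using no_gap_v0[of v0] first_gap[OF v0] by simp
qed

lemma vH_eq: "vH = z"
proof (rule ccontr)
  assume "vH \<noteq> z"
  then have "0 < vH - z"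
    using vH unfolding first_def by simp
  moreover have "gap vH (vH - z + (b - a))"
    using first_z_gap[of 0 vH] vH by simp
  ultimately show False
    by (rule no_gap_vH)
qed

section \<open>The orbit of the hole \<open>H'\<close> and the complement of
  \<open>S\<close>\<close>

lemma gap_orbit:
  assumes "n \<le> D"
  shows "gap ((R ^^ Suc n) 0) (b - a)"
proof -
  have "gap ((R ^^ Suc n) v0) (0 + (b - a))"
    using assms orbit_v0_vH_iff by (intro gap_R_orbit_v0) (auto simp: gap_def)
  then show ?thesis
    by (simp add: v0_eq)
qed

lemma zero_mem: "0 \<in> S"
  using v0_mem v0_eq by simp

lemma orbit_Q: "(R ^^ n) (Q + (b - a)) = (R ^^ Suc n) 0 + a * of_int (- 1)"
proof -
  have "Q + (b - a) = R 0 + a * of_int (- 1)"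
    using R_left(2)[of 0 0] c0_lower by simp
  then show ?thesis
    by (simp only: R_funpow_shift funpow_Suc_right comp_apply)
qed

lemma orbit_Q_cong: "acong ((R ^^ n) (Q + (b - a))) ((R ^^ Suc n) 0)"
  unfolding orbit_Q by (rule acong_shift)

lemma orbit_Q_mem: "(R ^^ n) (Q + (b - a)) \<in> S"
  using S_acong[OF orbit_Q_cong] S_R_funpow[OF zero_mem] by blast

text \<open>Before time \<open>D\<close> the right end of the arc is congruent to neither
  \<open>v0\<close> nor \<open>vH\<close>, so \<open>gap_translate\<close> moves the whole closed
  arc rigidly.\<close>

lemma orbit_Q_translate:
  assumes "n \<le> D" "0 \<le> y" "y \<le> b - a"
  shows "(R ^^ n) (Q + y) = (R ^^ n) Q + y"
proof -
  have step: "R ((R ^^ n) Q + y) = R ((R ^^ n) Q) + y"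
    if n: "n < D" and tr: "(R ^^ n) (Q + (b - a)) = (R ^^ n) Q + (b - a)"
      and y: "0 \<le> y" "y \<le> b - a" for n y
  proof -
    let ?v = "(R ^^ n) (Q + (b - a))"
    have "R (?v - x) = R ?v - x" if "0 \<le> x" "x \<le> b - a" for x
    proof (rule gap_translate(2)[OF orbit_Q_mem])
      show "gap ?v (b - a)"
        using gap_acong[OF orbit_Q_cong gap_orbit] n by simp
      show "\<not> acong ?v v0"
        using orbit_v0_avoids_v0[of "Suc n"] acong_trans[OF acong_sym[OF orbit_Q_cong[of n]], of v0]
        unfolding v0_eq by blast
      show "\<not> acong ?v vH"
        using orbit_v0_vH_iff[of "Suc n"] acong_trans[OF acong_sym[OF orbit_Q_cong[of n]], of vH] n
        unfolding v0_eq by auto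
    qed (use that a_less_b in auto)
    \<comment> \<open>Offsets so far run leftwards from the right end, which lies in
      \<open>S\<close>; comparing two of them rebases at the left end.\<close>
    from this[of "b - a - y"] this[of "b - a"] show ?thesis
      using y tr by simp
  qed
  show ?thesis
    using assms
  proof (induction n arbitrary: y)
    case (Suc n)
    then have "(R ^^ n) (Q + y) = (R ^^ n) Q + y" "(R ^^ n) (Q + (b - a)) = (R ^^ n) Q + (b - a)"
      using a_less_b by auto
    then show ?case
      using step[of n y] Suc.prems by simp
  qed simp
qed

lemma orbit_first:
  assumes "n \<le> D" "0 \<le> y" "y \<le> b - a"
  shows "first ((R ^^ n) Q + y) ((R ^^ n) Q + (b - a))"
proof -
  have "(R ^^ n) (Q + (b - a)) = (R ^^ n) Q + (b - a)"
    using assms orbit_Q_translate by simp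
  then show ?thesis
    using gap_first[OF orbit_Q_mem gap_acong[OF orbit_Q_cong gap_orbit[OF assms(1)]]] assms
    by simp
qed

lemma orbit_Q_notin_S:
  assumes "n \<le> D" "0 \<le> y" "y < b - a"
  shows "(R ^^ n) Q + y \<notin> S"
  using firstD[OF orbit_first[OF assms(1,2)]] assms by simp

text \<open>A point of the hole is fixed by \<open>R\<close>, so two successive arcs would share the
  first point of \<open>S\<close> to their right, against \<open>S_orbit_distinct\<close>.\<close>

lemma orbit_notin_hole:
  assumes "n < D" "0 \<le> y" "y < b - a"
  shows "(R ^^ n) Q + y \<notin> H"
proof
  assume hole: "(R ^^ n) Q + y \<in> H"
  have "(R ^^ Suc n) Q + y = (R ^^ n) Q + y"
    using R_hole[OF hole] orbit_Q_translate[of "Suc n" y] orbit_Q_translate[of n y] assms by simp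
  moreover have "first ((R ^^ Suc n) Q + y) ((R ^^ Suc n) Q + (b - a))"
    "first ((R ^^ n) Q + y) ((R ^^ n) Q + (b - a))"
    using orbit_first[of "Suc n" y] orbit_first[of n y] assms by linarith+
  ultimately have "(R ^^ Suc n) (Q + (b - a)) = (R ^^ n) (Q + (b - a))"
    using first_unique orbit_Q_translate[of n "b - a"] orbit_Q_translate[of "Suc n" "b - a"] assms
    by simp
  then show False
    using S_orbit_distinct[OF orbit_Q_mem[of 0], of "Suc n" n] acong_refl by simp
qed

lemma R'_orbit:
  assumes "n \<le> D" "0 \<le> y" "y < b - a"
  shows "(R' ^^ n) ((R ^^ D) Q + y) = (R ^^ (D - n)) Q + y"
  using assms(1)
proof (induction n)
  case (Suc n)
  define m where "m = D - Suc n"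
  have m: "D - n = Suc m" "m < D"
    using Suc.prems by (auto simp: m_def)
  have "(R ^^ Suc m) Q + y = R ((R ^^ m) Q + y)"
    using orbit_Q_translate[of "Suc m" y] orbit_Q_translate[of m y] assms m by simp
  then have "R' ((R ^^ Suc m) Q + y) = (R ^^ m) Q + y"
    using R'_R[OF orbit_notin_hole[OF m(2) assms(2,3)]] by simp
  then show ?case
    using Suc m by (simp add: m_def)
qed simp

text \<open>The last arc is the hole \<open>H\<close> modulo \<open>a\<close>: its right end is
  congruent to \<open>vH\<close>, which equals \<open>z\<close>.\<close>

lemma orbit_D_Q: "acong (z + a - b) ((R ^^ D) Q)"
proof -
  have "acong z ((R ^^ D) (Q + (b - a)))"
    using acong_trans[OF acong_sym[OF orbit_D]] acong_sym[OF orbit_Q_cong[of D]]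
    by (simp add: v0_eq vH_eq)
  then obtain k :: int where "z = (R ^^ D) Q + (b - a) + a * of_int k"
    using orbit_Q_translate[of D "b - a"] a_less_b unfolding acong_def by auto
  then show ?thesis
    unfolding acong_def by (intro exI[of _ k]) simp
qed

text \<open>The gap between \<open>t\<close> and the next point \<open>v\<close> of \<open>S\<close>
  cannot persist, so the orbit of \<open>v\<close> meets \<open>v0\<close> or \<open>vH\<close>. As
  \<open>v0\<close> has no gap on its left, it meets \<open>vH\<close> first; tracing back from
  there places \<open>v\<close> on the orbit segment from \<open>v0\<close> to
  \<open>vH\<close>.\<close>

lemma complement_subset:
  assumes "t \<notin> S"
  obtains n y and k :: int where "n \<le> D" "0 \<le> y" "y < b - a" "t = (R ^^ n) Q + y + a * of_int k"
proof -
  obtain v where v: "v \<in> S" "t \<le> v" "{t..<v} \<inter> S = {}"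
    using next_point[of t] v0_mem by blast
  define e where "e = v - t"
  have "v \<noteq> t"
    using v(1) assms by blast
  then have e: "0 < e" "gap v e"
    using v unfolding e_def gap_def by simp_all
  let ?hit = "\<lambda>i. acong ((R ^^ i) v) v0 \<or> acong ((R ^^ i) v) vH"
  have "\<exists>i. ?hit i"
  proof (rule ccontr)
    assume none: "\<not> ?thesis"
    have "gap ((R ^^ n) v) e" for n
      by (rule gap_R_funpow[OF v(1), of 0]) (use e none in simp_all)
    then show False
      by (rule no_persistent_gap[OF v(1) e(1)])
  qed
  define i where "i = (LEAST i. ?hit i)"
  have hit: "?hit i"
    using LeastI_ex[OF \<open>\<exists>i. ?hit i\<close>] unfolding i_def .
  have miss: "\<not> ?hit j" if "j < i" for j
    using not_less_Least[of j ?hit] that unfolding i_def by simp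
  have gap_i: "gap ((R ^^ i) v) e"
    by (rule gap_R_funpow[OF v(1), of 0]) (use e miss in simp_all)
  have "\<not> acong ((R ^^ i) v) v0"
    using no_gap_v0[OF e(1) gap_acong[OF acong_sym gap_i]] by blast
  with hit have hit_vH: "acong ((R ^^ i) v) vH" by blast
  have "e \<le> b - a"
  proof (rule ccontr)
    assume "\<not> e \<le> b - a"
    then show False
      using no_gap_vH[of "e - (b - a)"] gap_acong[OF acong_sym[OF hit_vH] gap_i] by simp
  qed
  have meet: "acong ((R ^^ i) v) ((R ^^ Suc D) v0)"
    using acong_trans[OF hit_vH acong_sym[OF orbit_D]] .
  \<comment> \<open>With a longer hitting time, cancelling \<open>Suc D\<close> steps would put
    \<open>v0\<close> on the orbit of \<open>v\<close> before the first hit.\<close>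
  have "i \<le> D"
  proof (rule ccontr)
    assume "\<not> i \<le> D"
    then obtain j where j: "i = Suc D + j"
      using le_Suc_ex[of "Suc D" i] by auto
    have "acong ((R ^^ j) v) v0"
      using S_R_cancel[OF S_R_funpow[OF v(1)] v0_mem, of "Suc D" j] meet unfolding j funpow_add
      by simp
    then show False
      using miss[of j] j by simp
  qed
  \<comment> \<open>\<open>v\<close> is \<open>i\<close> steps before \<open>vH\<close> and
    \<open>v0\<close> is \<open>Suc D\<close> steps before it, so \<open>v\<close> is
    \<open>Suc n\<close> steps after \<open>v0\<close>.\<close>
  define n where "n = D - i"
  have "Suc D = i + Suc n"
    using \<open>i \<le> D\<close> by (simp add: n_def)
  then have "(R ^^ Suc D) v0 = (R ^^ i) ((R ^^ Suc n) v0)"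
    by (simp only: funpow_add comp_apply)
  then have "acong v ((R ^^ Suc n) v0)"
    using S_R_cancel[OF v(1) S_R_funpow[OF v0_mem], of i "Suc n"] meet by simp
  then have "acong v ((R ^^ n) (Q + (b - a)))"
    using acong_trans[OF _ acong_sym[OF orbit_Q_cong[of n]], of v] by (simp add: v0_eq)
  then obtain k :: int where k: "v = (R ^^ n) Q + (b - a) + a * of_int k"
    using orbit_Q_translate[of n "b - a"] a_less_b unfolding acong_def n_def by auto
  show ?thesis
  proof (rule that)
    show "n \<le> D" "0 \<le> b - a - e" "b - a - e < b - a"
      using \<open>e \<le> b - a\<close> e by (auto simp: n_def)
    show "t = (R ^^ n) Q + (b - a - e) + a * of_int k"
      using k by (simp add: e_def)
  qed
qed

lemma complement_eq: "- S = (\<Union>n\<le>D. shiftset ((\<lambda>y. (R ^^ n) Q + y) ` {0..<b - a}) a)"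
proof (intro set_eqI iffI)
  fix t assume "t \<in> - S"
  then have "t \<notin> S" by simp
  then obtain n y and k :: int
    where "n \<le> D" "0 \<le> y" "y < b - a" "t = (R ^^ n) Q + y + a * of_int k"
    using complement_subset by blast
  then have "n \<in> {..D}" "t \<in> shiftset ((\<lambda>y. (R ^^ n) Q + y) ` {0..<b - a}) a"
    unfolding mem_shiftset_translate by auto
  then show "t \<in> (\<Union>n\<le>D. shiftset ((\<lambda>y. (R ^^ n) Q + y) ` {0..<b - a}) a)"
    by blast
next
  fix t assume "t \<in> (\<Union>n\<le>D. shiftset ((\<lambda>y. (R ^^ n) Q + y) ` {0..<b - a}) a)"
  then obtain n y and k :: int
    where "n \<le> D" "y \<in> {0..<b - a}" "t = (R ^^ n) Q + y + a * of_int k"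
    unfolding mem_shiftset_translate UN_iff by blast
  then show "t \<in> - S"
    using orbit_Q_notin_S by (auto simp: S_shift)
qed

text \<open>A common point would have both right ends as its first point of \<open>S\<close>. Closed
  arcs are covered too, because the right ends themselves belong to \<open>S\<close>.\<close>

lemma orbit_arcs_disjoint:
  assumes "n \<le> D" "m \<le> D" "n \<noteq> m"
  shows "shiftset ((\<lambda>y. (R ^^ n) Q + y) ` {0..b - a}) a \<inter>
         shiftset ((\<lambda>y. (R ^^ m) Q + y) ` {0..b - a}) a = {}"
proof (rule ccontr)
  assume "\<not> ?thesis"
  then obtain p where "p \<in> shiftset ((\<lambda>y. (R ^^ n) Q + y) ` {0..b - a}) a"
    "p \<in> shiftset ((\<lambda>y. (R ^^ m) Q + y) ` {0..b - a}) a" by blast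
  then obtain y y' and k j :: int where y: "y \<in> {0..b - a}" "p = (R ^^ n) Q + y + a * of_int k"
    and y': "y' \<in> {0..b - a}" "p = (R ^^ m) Q + y' + a * of_int j"
    unfolding mem_shiftset_translate by blast
  have "first p ((R ^^ n) Q + (b - a) + a * of_int k)"
    using first_shift[OF orbit_first[OF assms(1)]] y by simp
  moreover have "first p ((R ^^ m) Q + (b - a) + a * of_int j)"
    using first_shift[OF orbit_first[OF assms(2)]] y' by simp
  ultimately have "(R ^^ n) Q + (b - a) + a * of_int k = (R ^^ m) Q + (b - a) + a * of_int j"
    by (rule first_unique)
  then have "(R ^^ n) (Q + (b - a)) = (R ^^ m) (Q + (b - a)) + a * of_int (j - k)"
    using orbit_Q_translate[OF assms(1), of "b - a"] orbit_Q_translate[OF assms(2), of "b - a"] a_less_b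
    by (simp add: right_diff_distrib)
  then have "acong ((R ^^ n) (Q + (b - a))) ((R ^^ m) (Q + (b - a)))"
    unfolding acong_def by blast
  then have "n = m"
    using S_orbit_distinct[OF orbit_Q_mem[of 0]] by simp
  with assms(3) show False by contradiction
qed

text \<open>The packing bound applied to the \<open>D + 1\<close> right ends, each with a gap of
  length \<open>b - a\<close>.\<close>

lemma D_bound: "int D \<le> \<lfloor>a / (b - a)\<rfloor> - 1"
proof -
  have "int (card {..D}) \<le> \<lfloor>a / (b - a)\<rfloor>"
  proof (rule card_gaps_le[where f = "\<lambda>n. (R ^^ Suc n) 0"])
    show "i = j" if "acong ((R ^^ Suc i) 0) ((R ^^ Suc j) 0)" for i j
      using S_orbit_distinct[OF zero_mem that] by simp
  next
    fix i assume "i \<in> {..D}"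
    then show "gap ((R ^^ Suc i) 0) (b - a)"
      using gap_orbit by blast
    show "(R ^^ Suc i) 0 \<in> S"
      by (rule S_R_funpow[OF zero_mem])
  qed (use a_less_b in auto)
  then show ?thesis by simp
qed

lemma R'_orbit_hole:
  assumes "n \<le> D"
  obtains k :: int where "\<And>y. y \<in> {0..<b - a} \<Longrightarrow>
      (R' ^^ n) (z + a - b + y) = (R ^^ (D - n)) Q + a * of_int k + y"
proof -
  obtain k :: int where k: "z + a - b = (R ^^ D) Q + a * of_int k"
    using orbit_D_Q unfolding acong_def by blast
  show ?thesis
  proof (rule that)
    fix y :: real assume y: "y \<in> {0..<b - a}"
    have "(R' ^^ n) (z + a - b + y) = (R' ^^ n) ((R ^^ D) Q + y + a * of_int k)"
      unfolding k by (simp add: algebra_simps)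
    also have "\<dots> = (R ^^ (D - n)) Q + a * of_int k + y"
      unfolding R'_funpow_shift using R'_orbit[OF assms] y by simp
    finally show "(R' ^^ n) (z + a - b + y) = (R ^^ (D - n)) Q + a * of_int k + y" .
  qed
qed

lemma R'_orbit_hole_acong:
  assumes "n \<le> D"
  shows "acong ((R' ^^ n) (z + a - b)) ((R ^^ (D - n)) Q)"
proof -
  obtain k :: int where "\<And>y. y \<in> {0..<b - a} \<Longrightarrow>
      (R' ^^ n) (z + a - b + y) = (R ^^ (D - n)) Q + a * of_int k + y"
    using R'_orbit_hole[OF assms] by metis
  from this[of 0] show ?thesis
    unfolding acong_def using a_less_b by auto
qed

lemma image_R_cohole:
  assumes "n \<le> D"
  shows "(R ^^ n) ` shiftset {Q..<Q + b - a} a = shiftset ((\<lambda>y. (R ^^ n) Q + y) ` {0..<b - a}) a"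
proof -
  have *: "{Q..<Q + b - a} = (\<lambda>y. Q + y) ` {0..<b - a}"
    by (simp add: algebra_simps)
  show ?thesis
    unfolding * by (rule image_shiftset_translate)
      (use orbit_Q_translate[OF assms] in \<open>simp add: R_funpow_shift\<close>)
qed

lemma image_R'_hole:
  assumes "n \<le> D"
  shows "(R' ^^ n) ` shiftset {z + a - b..<z} a
       = shiftset ((\<lambda>y. (R' ^^ n) (z + a - b) + y) ` {0..<b - a}) a"
proof -
  obtain k :: int where k: "\<And>y. y \<in> {0..<b - a} \<Longrightarrow>
      (R' ^^ n) (z + a - b + y) = (R ^^ (D - n)) Q + a * of_int k + y"
    using R'_orbit_hole[OF assms] by metis
  have "(R' ^^ n) (z + a - b + y) = (R' ^^ n) (z + a - b) + y" if "y \<in> {0..<b - a}" for y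
    using k[of 0] k[OF that] a_less_b by simp
  moreover have *: "{z + a - b..<z} = (\<lambda>y. z + a - b + y) ` {0..<b - a}"
    by simp
  ultimately show ?thesis
    unfolding * by (intro image_shiftset_translate) (simp add: R'_funpow_shift)
qed

end

theorem theorem5p1:
  fixes a b c :: real
  assumes "0 < a" "0 < b" "0 < c" "a < b" "b < c"
    and "b - a < c0 b c" "c0 b c < a"
    and "\<lfloor>c / b\<rfloor> \<ge> 2"
    and "a / b \<notin> \<rat>"
    and "Sabc a b c \<noteq> {}"
  shows "\<exists>D::nat. int D \<le> \<lfloor>a / (b - a)\<rfloor> - 1 \<and>
     (\<forall>n\<le>D. shiftset {(Rtabc a b c ^^ n) (c0 b c + a - b)} a
              = shiftset {(Rabc a b c ^^ (D - n)) (c - c0 b c)} a) \<and>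
     (\<forall>n\<le>D. \<forall>m\<le>D. n \<noteq> m \<longrightarrow>
        shiftset ((\<lambda>y. (Rabc a b c ^^ n) (c - c0 b c) + y) ` {0..b - a}) a \<inter>
        shiftset ((\<lambda>y. (Rabc a b c ^^ m) (c - c0 b c) + y) ` {0..b - a}) a = {}) \<and>
     - Sabc a b c = (\<Union>n\<le>D. shiftset ((\<lambda>y. (Rabc a b c ^^ n) (c - c0 b c) + y) ` {0..<b - a}) a) \<and>
     (\<Union>n\<le>D. shiftset ((\<lambda>y. (Rabc a b c ^^ n) (c - c0 b c) + y) ` {0..<b - a}) a)
       = (\<Union>n\<le>D. (Rabc a b c ^^ n) ` shiftset {c - c0 b c..<c - c0 b c + b - a} a) \<and>
     (\<Union>n\<le>D. (Rabc a b c ^^ n) ` shiftset {c - c0 b c..<c - c0 b c + b - a} a)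
       = (\<Union>n\<le>D. (Rtabc a b c ^^ n) ` shiftset {c0 b c + a - b..<c0 b c} a) \<and>
     (\<Union>n\<le>D. (Rtabc a b c ^^ n) ` shiftset {c0 b c + a - b..<c0 b c} a)
       = (\<Union>n\<le>D. shiftset ((\<lambda>y. (Rtabc a b c ^^ n) (c0 b c + a - b) + y) ` {0..<b - a}) a)"
proof -
  interpret abc_params a b c
    using assms by unfold_locales
  obtain v0 where "first 0 v0"
    using next_point[OF assms(10), of 0] unfolding first_def by metis
  moreover obtain vH where "first z vH"
    using next_point[OF assms(10), of z] unfolding first_def by metis
  ultimately interpret abc_first a b c v0 vH
    by unfold_locales
  have cz: "c - z = Q"
    using c_eq by simp
  define arc where "arc n = shiftset ((\<lambda>y. (R ^^ n) Q + y) ` {0..<b - a}) a" for n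
  have arc_R': "shiftset ((\<lambda>y. (R' ^^ n) (z + a - b) + y) ` {0..<b - a}) a = arc (D - n)" if "n \<le> D" for n
    unfolding arc_def using shiftset_translate_acong[OF R'_orbit_hole_acong[OF that]] .
  \<comment> \<open>\<open>R'\<close> runs through the same arcs in reverse order, from
    \<open>H\<close> back to \<open>H'\<close>.\<close>
  have rev: "(\<Union>n\<le>D. arc (D - n)) = (\<Union>n\<le>D. arc n)"
  proof -
    have "x \<in> (\<lambda>n. D - n) ` {..D}" if "x \<le> D" for x
      using that by (intro image_eqI[of _ _ "D - x"]) auto
    then have rev: "(\<lambda>n. D - n) ` {..D} = {..D}"
      by auto
    have "(\<Union>n\<le>D. arc (D - n)) = \<Union> (arc ` (\<lambda>n. D - n) ` {..D})"
      unfolding image_image ..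
    then show ?thesis
      unfolding rev .
  qed
  have R_img: "(\<Union>n\<le>D. (R ^^ n) ` shiftset {Q..<Q + b - a} a) = (\<Union>n\<le>D. arc n)"
    unfolding arc_def by (intro SUP_cong refl) (simp add: image_R_cohole)
  have R'_arcs: "(\<Union>n\<le>D. shiftset ((\<lambda>y. (R' ^^ n) (z + a - b) + y) ` {0..<b - a}) a) = (\<Union>n\<le>D. arc n)"
    unfolding rev[symmetric] by (intro SUP_cong refl) (simp only: arc_R' atMost_iff)
  have R'_img: "(\<Union>n\<le>D. (R' ^^ n) ` shiftset {z + a - b..<z} a) = (\<Union>n\<le>D. arc n)"
    unfolding R'_arcs[symmetric] by (intro SUP_cong refl) (simp add: image_R'_hole)
  have points: "shiftset {(R' ^^ n) (z + a - b)} a = shiftset {(R ^^ (D - n)) Q} a" if "n \<le> D" for n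
    using shiftset_translate_acong[OF R'_orbit_hole_acong[OF that], of "{0}"] by simp
  show ?thesis
    unfolding cz
  proof (intro exI[of _ D] conjI allI impI)
    show "int D \<le> \<lfloor>a / (b - a)\<rfloor> - 1"
      by (rule D_bound)
    show "- S = (\<Union>n\<le>D. shiftset ((\<lambda>y. (R ^^ n) Q + y) ` {0..<b - a}) a)"
      by (rule complement_eq)
  qed (use orbit_arcs_disjoint in \<open>simp_all only: points R_img R'_img R'_arcs flip: arc_def\<close>)
qed

end
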